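(* Fix $R>0$. For two disk-type surfaces $\mathcal M=(\mathcal D,\mu)$ and $\mathcal N=(\mathcal D,\nu)$, let $$\mathbf d^R(\mathcal M,\mathcal N)=T^R_d(\mu,\nu):=\inf_{\pi\in\Pi(\mu,\nu)}\int_{\mathcal D\times\mathcal D}d^R_{\mu,\nu}(z,w)\,d\pi(z,w).$$ Then $\mathbf d^R$ defines a semi-metric on the space of disk-type surfaces.
   Context: $\mathcal D=\{z\in\mathbb C:|z|<1\}$, with hyperbolic area measure $d\mathrm{vol}_H(z)=(1-|z|^2)^{-2}\,dx^1\wedge dx^2$ for $z=x^1+ix^2$. $M_{\mathcal D}$ is the group of disk-preserving Möbius transformations $m(z)=e^{i\theta}\frac{z-a}{1-\bar a z}$, $a\in\mathcal D$, $\theta\in[0,2\pi)$. For $m\in M_{\mathcal D}$ and a function $\mu$ on $\mathcal D$: $m^*\mu=\mu\circ m$ and $m_*\mu=\mu\circ m^{-1}$. For $R>0$, $\Omega_{z_0,R}=\{z\in\mathcal D:\left|\frac{z-z_0}{1-\bar z_0z}\right|\le\tanh R\}$ is the hyperbolic geodesic disk of radius $R$ centered at $z_0$. A disk-type surface $\mathcal M$ is a surface with a smooth Riemannian metric, normalized to total area $1$, that admits an (orientation-preserving) conformal uniformization map onto $\mathcal D$. Such a map pushes the metric forward to $\mu(z)(1-|z|^2)^{-2}\delta_{ij}\,dx^i\otimes dx^j$, where $\mu>0$ is smooth and $\int_{\mathcal D}\mu\,d\mathrm{vol}_H=1$; $\mu$ is called a conformal factor (hyperbolic density) of $\mathcal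 M$, and one writes $\mathcal M=(\mathcal D,\mu)$. The conformal factors of a given surface obtained from different uniformization maps are exactly the functions $m_*\mu$, $m\in M_{\mathcal D}$. The symbol $\mu$ also denotes the probability measure $\mu\,d\mathrm{vol}_H$ on $\mathcal D$. $\Pi(\mu,\nu)$ is the set of probability measures on $\mathcal D\times\mathcal D$ with marginals $\mu$ and $\nu$. For $z_0,w_0\in\mathcal D$, $$d^R_{\mu,\nu}(z_0,w_0)=\inf_{m\in M_{\mathcal D},\,m(z_0)=w_0}\int_{\Omega_{z_0,R}}|\mu(z)-\nu(m(z))|\,d\mathrm{vol}_H(z).$$ A semi-metric is a real-valued function of pairs that is non-negative, symmetric, satisfies the triangle inequality, and vanishes on pairs of identical surfaces (so in particular $T^R_d(\mu,m_*\mu)=0$ for all $m\in M_{\mathcal D}$, since $\mu$ and $m_*\mu$ represent the same surface); distinct elements are allowed to be at distance $0$. *)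

theory Defs
  imports "HOL-Complex_Analysis.Complex_Analysis" "HOL-Probability.Probability"
begin

section \<open>Smooth maps between open subsets of normed spaces\<close>

text \<open>
  For open \<open>S\<close>, \<open>Ck_on k f S\<close> says that \<open>f\<close> is of class \<open>C\<^sup>k\<close> on \<open>S\<close>; derivatives of order \<open>k\<close> are
  taken as iterated directional derivatives. It is only meant for finite-dimensional domains and
  only used there.
\<close>

primrec Ck_on :: "nat \<Rightarrow> ('a::real_normed_vector \<Rightarrow> 'b::real_normed_vector) \<Rightarrow> 'a set \<Rightarrow> bool" where
  "Ck_on 0 f S \<longleftrightarrow> continuous_on S f"
| "Ck_on (Suc k) f S \<longleftrightarrow>
     (\<forall>x\<in>S. f differentiable (at x)) \<and> (\<forall>v. Ck_on k (\<lambda>x. frechet_derivative f (at x) v) S)"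

definition smooth_on :: "('a::real_normed_vector \<Rightarrow> 'b::real_normed_vector) \<Rightarrow> 'a set \<Rightarrow> bool" where
  "smooth_on f S \<longleftrightarrow> (\<forall>k. Ck_on k f S)"

text \<open>The determinant of a real-linear map of the plane.\<close>

definition plane_det :: "(complex \<Rightarrow> complex) \<Rightarrow> real" where
  "plane_det L = Re (L 1) * Im (L \<i>) - Im (L 1) * Re (L \<i>)"


section \<open>Oriented Riemannian surfaces\<close>

text \<open>
  A chart is a pair \<open>(U, \<phi>)\<close> of an open set and a homeomorphism of \<open>U\<close> onto an open subset of
  the plane. \<open>metric c z v w\<close> is the inner product, at the point with coordinate \<open>z\<close> in the chart
  \<open>c\<close>, of the tangent vectors with components \<open>v\<close> and \<open>w\<close> in that chart; it is only meaningful
  for \<open>c\<close> in the atlas and \<open>z\<close> in the image of \<open>c\<close>.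
\<close>

type_synonym 'a chart = "'a set \<times> ('a \<Rightarrow> complex)"

record 'a surface =
  stop :: "'a topology"
  atlas :: "'a chart set"
  metric :: "'a chart \<Rightarrow> complex \<Rightarrow> complex \<Rightarrow> complex \<Rightarrow> real"

definition local_dom :: "'a chart \<Rightarrow> ('a \<Rightarrow> 'b) \<Rightarrow> 'b chart \<Rightarrow> complex set" where
  "local_dom c f c' = snd c ` (fst c \<inter> f -` fst c')"

definition local_rep :: "'a chart \<Rightarrow> ('a \<Rightarrow> 'b) \<Rightarrow> 'b chart \<Rightarrow> complex \<Rightarrow> complex" where
  "local_rep c f c' = snd c' \<circ> f \<circ> inv_into (fst c) (snd c)"

text \<open>
  An orientation-preserving diffeomorphism: a homeomorphism that is smooth with positive Jacobian
  determinant in charts (the inverse is then smooth by the inverse function theorem).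
\<close>

definition oriented_diffeo :: "'a surface \<Rightarrow> 'b surface \<Rightarrow> ('a \<Rightarrow> 'b) \<Rightarrow> bool" where
  "oriented_diffeo M N f \<longleftrightarrow>
     homeomorphic_map (stop M) (stop N) f \<and>
     (\<forall>c\<in>atlas M. \<forall>c'\<in>atlas N.
        smooth_on (local_rep c f c') (local_dom c f c') \<and>
        (\<forall>z\<in>local_dom c f c'. plane_det (frechet_derivative (local_rep c f c') (at z)) > 0))"

text \<open>\<open>pullback_metric N f c c'\<close> is the metric \<open>f\<^sup>*g\<^sub>N\<close> written in the charts \<open>c\<close> and \<open>c'\<close>.\<close>

definition pullback_metric ::
    "'b surface \<Rightarrow> ('a \<Rightarrow> 'b) \<Rightarrow> 'a chart \<Rightarrow> 'b chart \<Rightarrow> complex \<Rightarrow> complex \<Rightarrow> complex \<Rightarrow> real" where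
  "pullback_metric N f c c' z v w =
     (let F = local_rep c f c'; D = frechet_derivative F (at z) in metric N c' (F z) (D v) (D w))"

definition conformal :: "'a surface \<Rightarrow> 'b surface \<Rightarrow> ('a \<Rightarrow> 'b) \<Rightarrow> bool" where
  "conformal M N f \<longleftrightarrow>
     oriented_diffeo M N f \<and>
     (\<exists>\<rho> :: 'a \<Rightarrow> real. (\<forall>p\<in>topspace (stop M). \<rho> p > 0) \<and>
        (\<forall>c\<in>atlas M. \<forall>c'\<in>atlas N. \<forall>z\<in>local_dom c f c'. \<forall>v w.
           pullback_metric N f c c' z v w = \<rho> (inv_into (fst c) (snd c) z) * metric M c z v w))"

definition isometry :: "'a surface \<Rightarrow> 'b surface \<Rightarrow> ('a \<Rightarrow> 'b) \<Rightarrow> bool" where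
  "isometry M N f \<longleftrightarrow>
     oriented_diffeo M N f \<and>
     (\<forall>c\<in>atlas M. \<forall>c'\<in>atlas N. \<forall>z\<in>local_dom c f c'. \<forall>v w.
        pullback_metric N f c c' z v w = metric M c z v w)"

definition isometric :: "'a surface \<Rightarrow> 'b surface \<Rightarrow> bool" where
  "isometric M N \<longleftrightarrow> (\<exists>f. isometry M N f)"

text \<open>
  The condition \<open>isometry M M id\<close> says that the transition maps of the atlas are smooth and
  orientation-preserving and that the local expressions of the metric transform as a tensor.
\<close>

definition riemannian_surface :: "'a surface \<Rightarrow> bool" where
  "riemannian_surface M \<longleftrightarrow>
     Hausdorff_space (stop M) \<and> second_countable (stop M) \<and>
     (\<Union>c\<in>atlas M. fst c) = topspace (stop M) \<and>
     (\<forall>c\<in>atlas M.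
        openin (stop M) (fst c) \<and> open (snd c ` fst c) \<and>
        homeomorphic_map (subtopology (stop M) (fst c)) (top_of_set (snd c ` fst c)) (snd c)) \<and>
     (\<forall>c\<in>atlas M.
        (\<forall>v w. smooth_on (\<lambda>z. metric M c z v w) (snd c ` fst c)) \<and>
        (\<forall>z\<in>snd c ` fst c. \<forall>v.
           linear (metric M c z v) \<and>
           (\<forall>w. metric M c z v w = metric M c z w v) \<and>
           (v \<noteq> 0 \<longrightarrow> metric M c z v v > 0))) \<and>
     isometry M M id"


section \<open>The hyperbolic disk\<close>

abbreviation disk :: "complex set" where
  "disk \<equiv> ball 0 1"

definition vol_H :: "complex measure" where
  "vol_H = density (restrict_space lborel disk) (\<lambda>z. ennreal (1 / (1 - (norm z)\<^sup>2)\<^sup>2))"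

text \<open>
  The group of disk-preserving Moebius transformations. Its elements are functions on all of
  \<open>complex\<close>; only their restrictions to the disk matter below.
\<close>

definition moebius_disk :: "(complex \<Rightarrow> complex) set" where
  "moebius_disk = {Moebius_function \<theta> a | \<theta> a. a \<in> disk \<and> \<theta> \<in> {0..<2 * pi}}"

definition pushforward :: "(complex \<Rightarrow> complex) \<Rightarrow> (complex \<Rightarrow> real) \<Rightarrow> complex \<Rightarrow> real" where
  "pushforward m \<mu> = \<mu> \<circ> inv_into disk m"

definition geodesic_disk :: "complex \<Rightarrow> real \<Rightarrow> complex set" where
  "geodesic_disk z0 R = {z \<in> disk. norm ((z - z0) / (1 - cnj z0 * z)) \<le> tanh R}"


section \<open>Disk-type surfaces and their conformal factors\<close>

text \<open>The disk with the metric \<open>\<mu>(z) (1 - |z|\<^sup>2)\<^sup>-\<^sup>2 \<delta>\<^sub>i\<^sub>j dx\<^sup>i \<otimes> dx\<^sup>j\<close>.\<close>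

definition disk_surface :: "(complex \<Rightarrow> real) \<Rightarrow> complex surface" where
  "disk_surface \<mu> =
     \<lparr>stop = top_of_set disk, atlas = {(disk, id)},
      metric = (\<lambda>c z v w. \<mu> z * (1 / (1 - (norm z)\<^sup>2)\<^sup>2) * (v \<bullet> w))\<rparr>"

definition hyperbolic_density :: "(complex \<Rightarrow> real) \<Rightarrow> bool" where
  "hyperbolic_density \<mu> \<longleftrightarrow>
     smooth_on \<mu> disk \<and> (\<forall>z\<in>disk. \<mu> z > 0) \<and> has_bochner_integral vol_H \<mu> 1"

definition uniformization :: "'a surface \<Rightarrow> (complex \<Rightarrow> real) \<Rightarrow> ('a \<Rightarrow> complex) \<Rightarrow> bool" where
  "uniformization M \<mu> f \<longleftrightarrow> conformal M (disk_surface (\<lambda>_. 1)) f \<and> isometry M (disk_surface \<mu>) f"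

text \<open>
  \<open>uniformization M \<mu> f\<close> says that \<open>f\<close> is a conformal map of \<open>M\<close> onto the disk which pushes the
  metric of \<open>M\<close> forward to that of \<open>disk_surface \<mu>\<close>. The total area of \<open>M\<close> is then the integral of
  \<open>\<mu>\<close> with respect to \<open>vol_H\<close>, so that the normalization to area 1 is the last condition of
  \<open>hyperbolic_density \<mu>\<close>.
\<close>

definition conformal_factors :: "'a surface \<Rightarrow> (complex \<Rightarrow> real) set" where
  "conformal_factors M = {\<mu>. hyperbolic_density \<mu> \<and> (\<exists>f. uniformization M \<mu> f)}"

definition disk_type_surfaces :: "'a surface set" where
  "disk_type_surfaces = {M. riemannian_surface M \<and> (\<exists>\<mu> f. hyperbolic_density \<mu> \<and> uniformization M \<mu> f)}"


section \<open>The transportation distance\<close>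

definition density_measure :: "(complex \<Rightarrow> real) \<Rightarrow> complex measure" where
  "density_measure \<mu> = density vol_H (\<lambda>z. ennreal (\<mu> z))"

definition couplings ::
    "(complex \<Rightarrow> real) \<Rightarrow> (complex \<Rightarrow> real) \<Rightarrow> (complex \<times> complex) measure set" where
  "couplings \<mu> \<nu> =
     {\<pi>. prob_space \<pi> \<and> sets \<pi> = sets (vol_H \<Otimes>\<^sub>M vol_H) \<and>
         distr \<pi> vol_H fst = density_measure \<mu> \<and> distr \<pi> vol_H snd = density_measure \<nu>}"

definition local_cost ::
    "real \<Rightarrow> (complex \<Rightarrow> real) \<Rightarrow> (complex \<Rightarrow> real) \<Rightarrow> complex \<Rightarrow> complex \<Rightarrow> real" where
  "local_cost R \<mu> \<nu> z0 w0 =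
     (INF m\<in>{m \<in> moebius_disk. m z0 = w0}. LINT z:geodesic_disk z0 R|vol_H. \<bar>\<mu> z - \<nu> (m z)\<bar>)"

definition transport_cost :: "real \<Rightarrow> (complex \<Rightarrow> real) \<Rightarrow> (complex \<Rightarrow> real) \<Rightarrow> real" where
  "transport_cost R \<mu> \<nu> = (INF \<pi>\<in>couplings \<mu> \<nu>. LINT p|\<pi>. local_cost R \<mu> \<nu> (fst p) (snd p))"

text \<open>
  The distance of two surfaces, computed from an arbitrary choice of conformal factors. That the
  choice is irrelevant has to be proved.
\<close>

definition surface_dist :: "real \<Rightarrow> 'a surface \<Rightarrow> 'b surface \<Rightarrow> real" where
  "surface_dist R M N =
     transport_cost R (SOME \<mu>. \<mu> \<in> conformal_factors M) (SOME \<nu>. \<nu> \<in> conformal_factors N)"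

text \<open>
  A semi-metric on \<open>X\<close>, whose elements are regarded as identical when related by \<open>same\<close>; distinct
  elements may have distance 0.
\<close>

definition semi_metric_on :: "'b set \<Rightarrow> ('b \<Rightarrow> 'b \<Rightarrow> bool) \<Rightarrow> ('b \<Rightarrow> 'b \<Rightarrow> real) \<Rightarrow> bool" where
  "semi_metric_on X same d \<longleftrightarrow>
     (\<forall>x\<in>X. \<forall>y\<in>X. d x y \<ge> 0) \<and>
     (\<forall>x\<in>X. \<forall>y\<in>X. d x y = d y x) \<and>
     (\<forall>x\<in>X. \<forall>y\<in>X. \<forall>z\<in>X. d x z \<le> d x y + d y z) \<and>
     (\<forall>x\<in>X. \<forall>y\<in>X. same x y \<longrightarrow> d x y = 0)"

end

theory Submission
  imports Defs
begin

text \<open>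
  The local cost is invariant under Moebius transformations of either variable because these preserve
  hyperbolic area and hyperbolic disks; symmetry and the triangle inequality pass from functions on
  disks to the local cost. For the triangle inequality of the transport cost, two plans with common
  marginal \<open>\<nu>\<close> are glued without disintegration: \<open>local_cost R \<nu> \<nu>\<close> is upper semicontinuous and zero
  on the diagonal, so the disk splits into countably many cells of small diameter for it, and gluing
  cell by cell costs only an arbitrarily small error. If \<open>\<nu> \<circ> m = \<mu>\<close>, the plan carried by the graph of \<open>m\<close>
  has cost 0, so by the triangle inequality the transport cost does not depend on the choice of
  conformal factors. Finally, two uniformizations of isometric surfaces differ by an
  orientation-preserving conformal bijection of the disk, which is holomorphic and hence, by the
  Schwarz lemma, a Moebius transformation.
\<close>

section \<open>Automorphisms of the disk\<close>

text \<open>Two default values shape the argument: on the reals \<open>INF\<close> over an empty set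
  is unspecified, and the Bochner integral of a function that is not integrable is 0. The infima
  therefore have to range over nonempty sets, and the local cost has to be integrable against every
  plan. Transitivity of the group and the product plan settle the first point. For the second, the
  local cost is at most 2, because every density has mass 1, and it is measurable because its strict
  sublevel sets are open; an infimum over uncountably many transformations thus requires no
  measurable choice of a minimizer. In the gluing the two middle points \<open>y\<close> and
  \<open>y'\<close> are only close, not equal, and the mismatch is charged to the triangle
  inequality of the local cost along \<open>x\<close>, \<open>y\<close>, \<open>y'\<close>,
  \<open>z\<close>. Conformal factors are compared through first derivatives alone: a conformal
  linear map of the plane with positive determinant is complex linear, and the formula for the
  derivative of a Moebius transformation then cancels the hyperbolic weights, leaving
  \<open>\<nu> \<circ> m = \<mu>\<close>.\<close>

definition disk_automorphism :: "(complex \<Rightarrow> complex) \<Rightarrow> bool" where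
  "disk_automorphism f \<longleftrightarrow> f holomorphic_on disk \<and> f \<in> disk \<rightarrow> disk \<and>
     (\<exists>g. g holomorphic_on disk \<and> g \<in> disk \<rightarrow> disk \<and> (\<forall>z\<in>disk. f (g z) = z \<and> g (f z) = z))"

lemma one_minus_cnj_mult_nonzero:
  assumes "a \<in> disk" "z \<in> disk"
  shows "1 - cnj a * z \<noteq> 0"
proof -
  have "norm (cnj a * z) < 1"
    using norm_mult_less[of "cnj a" 1 z 1] assms by simp
  then show ?thesis by auto
qed

lemma Moebius_function_rotate: "Moebius_function \<theta> a z = cis \<theta> * Moebius_function 0 a z"
  by (simp add: Moebius_function_def cis_conv_exp)

lemma disk_automorphism_comp:
  assumes "disk_automorphism f" "disk_automorphism g"
  shows "disk_automorphism (f \<circ> g)"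
proof -
  obtain f' where f': "f' holomorphic_on disk" "f' \<in> disk \<rightarrow> disk" "\<And>z. z\<in>disk \<Longrightarrow> f (f' z) = z \<and> f' (f z) = z"
    using assms(1) unfolding disk_automorphism_def by blast
  obtain g' where g': "g' holomorphic_on disk" "g' \<in> disk \<rightarrow> disk" "\<And>z. z\<in>disk \<Longrightarrow> g (g' z) = z \<and> g' (g z) = z"
    using assms(2) unfolding disk_automorphism_def by blast
  have fg: "f holomorphic_on disk" "f \<in> disk \<rightarrow> disk" "g holomorphic_on disk" "g \<in> disk \<rightarrow> disk"
    using assms unfolding disk_automorphism_def by blast+
  show ?thesis
    unfolding disk_automorphism_def
  proof (intro conjI exI[of _ "g' \<circ> f'"])
    show "f \<circ> g holomorphic_on disk" "g' \<circ> f' holomorphic_on disk"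
      using fg f' g' by (auto intro!: holomorphic_on_compose_gen)
    show "\<forall>z\<in>disk. (f \<circ> g) ((g' \<circ> f') z) = z \<and> (g' \<circ> f') ((f \<circ> g) z) = z"
      using fg f' g' by (simp add: Pi_iff del: mem_ball_0)
  qed (use fg f' g' in \<open>auto simp: Pi_iff\<close>)
qed

lemma disk_automorphism_rotation:
  assumes "norm c = 1"
  shows "disk_automorphism (\<lambda>z. c * z)"
proof -
  have "c \<noteq> 0" using assms by auto
  then show ?thesis
    unfolding disk_automorphism_def using assms
    by (intro conjI exI[of _ "\<lambda>z. z / c"]) (auto simp: norm_mult norm_divide intro!: holomorphic_intros)
qed

lemma disk_automorphism_Moebius:
  assumes "a \<in> disk"
  shows "disk_automorphism (Moebius_function \<theta> a)"
proof -
  have "disk_automorphism (Moebius_function 0 a)"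
    unfolding disk_automorphism_def
    using assms Moebius_function_compose[of a "-a"] Moebius_function_compose[of "-a" a]
    by (intro conjI exI[of _ "Moebius_function 0 (-a)"])
       (auto intro!: Moebius_function_holomorphic Moebius_function_norm_lt_1)
  then have "disk_automorphism ((\<lambda>z. cis \<theta> * z) \<circ> Moebius_function 0 a)"
    by (intro disk_automorphism_comp disk_automorphism_rotation) auto
  moreover have "(\<lambda>z. cis \<theta> * z) \<circ> Moebius_function 0 a = Moebius_function \<theta> a"
    by (simp add: fun_eq_iff Moebius_function_rotate[of \<theta>])
  ultimately show ?thesis by simp
qed

lemma moebius_disk_automorphism: "m \<in> moebius_disk \<Longrightarrow> disk_automorphism m"
  unfolding moebius_disk_def using disk_automorphism_Moebius by blast

text \<open>Moving \<open>a = g 0\<close> to 0 by a Moebius transformation turns \<open>f\<close>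
  into a map \<open>F\<close> fixing 0 whose left inverse \<open>G\<close> fixes 0 as well. The
  Schwarz bounds for \<open>F\<close> and \<open>G\<close> together force equality, so
  \<open>F\<close> is a rotation.\<close>

lemma disk_automorphism_is_moebius:
  assumes "disk_automorphism f"
  obtains m where "m \<in> moebius_disk" "\<And>z. z \<in> disk \<Longrightarrow> m z = f z"
proof -
  obtain g where g: "g holomorphic_on disk" "g \<in> disk \<rightarrow> disk" "\<And>z. z\<in>disk \<Longrightarrow> f (g z) = z \<and> g (f z) = z"
    using assms unfolding disk_automorphism_def by blast
  have f: "f holomorphic_on disk" "f \<in> disk \<rightarrow> disk"
    using assms unfolding disk_automorphism_def by blast+
  define a where "a = g 0"
  define T where "T = Moebius_function 0 a"
  define T' where "T' = Moebius_function 0 (-a)"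
  have a: "a \<in> disk" using g by (simp add: a_def Pi_iff)
  then have ma: "- a \<in> disk" by simp
  have T: "T holomorphic_on disk" "T \<in> disk \<rightarrow> disk" "T' holomorphic_on disk" "T' \<in> disk \<rightarrow> disk"
    using disk_automorphism_Moebius[OF a, of 0] disk_automorphism_Moebius[OF ma, of 0]
    unfolding disk_automorphism_def T_def T'_def by blast+
  have TT: "T (T' z) = z" "T' (T z) = z" if "z \<in> disk" for z
    using Moebius_function_compose[of a "-a" z] Moebius_function_compose[of "-a" a z] a that
    by (auto simp: T_def T'_def)
  define F where "F = f \<circ> T'"
  define G where "G = T \<circ> g"
  have T0: "T' 0 = a" "T a = 0"
    by (auto simp: T_def T'_def Moebius_function_of_zero Moebius_function_eq_zero)
  have FG: "F holomorphic_on disk" "G holomorphic_on disk" "F \<in> disk \<rightarrow> disk" "G \<in> disk \<rightarrow> disk"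
    unfolding F_def G_def using T f g by (auto intro!: holomorphic_on_compose_gen simp: Pi_iff)
  have F0: "F 0 = 0" "G 0 = 0"
    using g(3)[of 0] by (auto simp: F_def G_def T0 a_def[symmetric])
  have GF: "G (F z) = z" if "z \<in> disk" for z
    using that TT g T by (simp add: F_def G_def Pi_iff del: mem_ball_0)
  have leF: "norm (F z) \<le> norm z" and leG: "norm (G z) \<le> norm z" if "z \<in> disk" for z
    using Schwarz_Lemma(1)[OF FG(1) F0(1), of z] Schwarz_Lemma(1)[OF FG(2) F0(2), of z] FG(3,4) that
    by (auto simp: Pi_iff)
  \<comment> \<open>Equality in the Schwarz lemma at a single nonzero point suffices; 1/2 is an
    arbitrary such point.\<close>
  have half: "(1/2::complex) \<in> disk" by simp
  have "norm (F (1/2)) = norm (1/2::complex)"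
  proof (rule antisym)
    show "norm (1/2::complex) \<le> norm (F (1/2))"
      using leG[of "F (1/2)"] GF[OF half] FG(3) half by (auto simp: Pi_iff)
  qed (rule leF[OF half])
  then have "\<exists>\<alpha>. (\<forall>z. norm z < 1 \<longrightarrow> F z = \<alpha> * z) \<and> norm \<alpha> = 1"
    using Schwarz_Lemma(3)[OF FG(1) F0(1), of 0] FG(3) half
    by (intro Schwarz_Lemma(3)[OF FG(1) F0(1), of 0] disjI1 exI[of _ "1/2"]) (auto simp: Pi_iff)
  then obtain \<alpha> where \<alpha>: "\<And>z. z \<in> disk \<Longrightarrow> F z = \<alpha> * z" "norm \<alpha> = 1" by auto
  \<comment> \<open>\<open>Arg2pi\<close> takes its values in the range that
    \<open>moebius_disk\<close> prescribes for the angle.\<close>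
  define \<theta> where "\<theta> = Arg2pi \<alpha>"
  have c: "cis \<theta> = \<alpha>"
    using Arg2pi[of \<alpha>] \<alpha>(2) by (simp add: cis_conv_exp is_Arg_def \<theta>_def)
  have "\<theta> \<in> {0..<2*pi}"
    using Arg2pi[of \<alpha>] by (auto simp: \<theta>_def)
  with a have "Moebius_function \<theta> a \<in> moebius_disk"
    unfolding moebius_disk_def by blast
  moreover have "Moebius_function \<theta> a z = f z" if "z \<in> disk" for z
    using \<alpha>(1)[of "T z"] TT[OF that] T that
    by (simp add: Moebius_function_rotate[of \<theta>] c T_def[symmetric] F_def Pi_iff del: mem_ball_0)
  ultimately show ?thesis using that by blast
qed

lemma moebius_disk_mem:
  assumes "m \<in> moebius_disk" "z \<in> disk" shows "m z \<in> disk"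
  using moebius_disk_automorphism[OF assms(1)] assms(2) unfolding disk_automorphism_def
  by (auto simp: Pi_iff)

lemma moebius_disk_id: "id \<in> moebius_disk"
proof -
  have "Moebius_function 0 0 = id" by (auto simp: Moebius_function_def)
  moreover have "Moebius_function 0 0 \<in> moebius_disk" unfolding moebius_disk_def
    by (auto intro!: exI[of _ "0::real"] exI[of _ "0::complex"])
  ultimately show ?thesis by simp
qed

text \<open>The product is described on the disk only: as functions on all of \<open>complex\<close>
  the transformations are not closed under composition, since division by zero returns 0 at a pole.
  Passing through \<open>disk_automorphism\<close>, which looks at the disk alone, also avoids
  computing the parameters of the product.\<close>

lemma moebius_disk_comp:
  assumes "m \<in> moebius_disk" "m' \<in> moebius_disk"
  obtains n where "n \<in> moebius_disk" "\<And>z. z \<in> disk \<Longrightarrow> n z = m (m' z)"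
  using disk_automorphism_is_moebius[OF disk_automorphism_comp[OF assms[THEN moebius_disk_automorphism]]]
  by auto

lemma moebius_disk_inverse:
  assumes "m \<in> moebius_disk"
  obtains n where "n \<in> moebius_disk" "\<And>z. z \<in> disk \<Longrightarrow> n (m z) = z" "\<And>z. z \<in> disk \<Longrightarrow> m (n z) = z"
proof -
  from moebius_disk_automorphism[OF assms] have f: "m holomorphic_on disk" "m \<in> disk \<rightarrow> disk"
    unfolding disk_automorphism_def by blast+
  from moebius_disk_automorphism[OF assms]
  obtain g where g: "g holomorphic_on disk" "g \<in> disk \<rightarrow> disk" "\<And>z. z\<in>disk \<Longrightarrow> m (g z) = z \<and> g (m z) = z"
    unfolding disk_automorphism_def by blast
  with f have "disk_automorphism g" unfolding disk_automorphism_def by blast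
  then obtain n where "n \<in> moebius_disk" "\<And>z. z \<in> disk \<Longrightarrow> n z = g z"
    using disk_automorphism_is_moebius by blast
  with g f show ?thesis using that[of n] by (simp add: Pi_iff del: mem_ball_0)
qed

lemma moebius_disk_bij:
  assumes "m \<in> moebius_disk" shows "bij_betw m disk disk"
proof -
  obtain n where "n \<in> moebius_disk" "\<And>z. z \<in> disk \<Longrightarrow> n (m z) = z" "\<And>z. z \<in> disk \<Longrightarrow> m (n z) = z"
    using moebius_disk_inverse[OF assms] by blast
  then show ?thesis using moebius_disk_mem[OF assms] moebius_disk_mem[of n]
    by (intro bij_betw_byWitness[where f'=n]) blast+
qed

lemma moebius_disk_holomorphic: "m \<in> moebius_disk \<Longrightarrow> m holomorphic_on disk"
  using moebius_disk_automorphism unfolding disk_automorphism_def by blast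

lemma moebius_disk_continuous: "m \<in> moebius_disk \<Longrightarrow> continuous_on disk m"
  by (simp add: holomorphic_on_imp_continuous_on moebius_disk_holomorphic)

lemma moebius_disk_transitive:
  assumes "z \<in> disk" "w \<in> disk"
  obtains m where "m \<in> moebius_disk" "m z = w"
proof -
  have z: "Moebius_function 0 z \<in> moebius_disk" and w: "Moebius_function 0 (-w) \<in> moebius_disk"
    using assms unfolding moebius_disk_def by (auto intro!: exI[of _ "0::real"])
  obtain n where "n \<in> moebius_disk" "\<And>x. x \<in> disk \<Longrightarrow> n x = Moebius_function 0 (-w) (Moebius_function 0 z x)"
    using moebius_disk_comp[OF w z] by blast
  then show ?thesis using assms that[of n]
    by (simp add: Moebius_function_eq_zero Moebius_function_of_zero)
qed

lemma moebius_disk_fixing_0: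
  assumes "m \<in> moebius_disk" "m 0 = 0"
  obtains \<theta> where "m = (\<lambda>z. cis \<theta> * z)"
proof -
  obtain \<theta> a where m: "m = Moebius_function \<theta> a" using assms(1) unfolding moebius_disk_def by auto
  with assms(2) have "a = 0" by (simp add: Moebius_function_of_zero)
  then show ?thesis using m that[of \<theta>] by (auto simp: Moebius_function_def cis_conv_exp fun_eq_iff)
qed

section \<open>Explicit formulas: derivative and pseudo-hyperbolic distance\<close>

text \<open>Rests on the identity \<open>(norm (1 - cnj a * z))\<^sup>2 - (norm (z - a))\<^sup>2 =
  (1 - (norm a)\<^sup>2) * (1 - (norm z)\<^sup>2)\<close>. It is the source of both invariance
  properties below, that of the area density and that of the distance.\<close>

lemma norm_Moebius_function_sq:
  assumes "a \<in> disk" "z \<in> disk"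
  shows "1 - (norm (Moebius_function \<theta> a z))\<^sup>2
     = (1 - (norm a)\<^sup>2) * (1 - (norm z)\<^sup>2) / (norm (1 - cnj a * z))\<^sup>2"
proof -
  have nz: "norm (1 - cnj a * z) \<noteq> 0" using one_minus_cnj_mult_nonzero[OF assms] by simp
  have "(norm (Moebius_function \<theta> a z))\<^sup>2 = (norm (z - a))\<^sup>2 / (norm (1 - cnj a * z))\<^sup>2"
    by (simp add: Moebius_function_def norm_mult norm_divide power_divide)
  moreover have "(norm (1 - cnj a * z))\<^sup>2 - (norm (z - a))\<^sup>2 = (1 - (norm a)\<^sup>2) * (1 - (norm z)\<^sup>2)"
    unfolding cmod_power2 by (simp add: algebra_simps power2_eq_square)
  moreover have "1 - n / d = (d - n) / d" if "d \<noteq> 0" for n d :: real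
    using that by (simp add: diff_divide_distrib)
  ultimately show ?thesis using nz by simp
qed

lemma Moebius_function_has_field_derivative:
  assumes "a \<in> disk" "z \<in> disk"
  shows "(Moebius_function \<theta> a has_field_derivative cis \<theta> * (1 - (norm a)\<^sup>2) / (1 - cnj a * z)\<^sup>2) (at z)"
proof -
  have nz: "1 - cnj a * z \<noteq> 0" using one_minus_cnj_mult_nonzero[OF assms] by simp
  have "((\<lambda>z. cis \<theta> * (z - a) / (1 - cnj a * z)) has_field_derivative
     ((cis \<theta> * 1) * (1 - cnj a * z) - (cis \<theta> * (z - a)) * (- cnj a)) / ((1 - cnj a * z) * (1 - cnj a * z))) (at z)"
    by (intro DERIV_divide DERIV_cmult nz)
       (auto intro!: derivative_eq_intros)
  moreover have "(cis \<theta> * 1) * (1 - cnj a * z) - (cis \<theta> * (z - a)) * (- cnj a) = cis \<theta> * (1 - (norm a)\<^sup>2)"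
    using complex_norm_square[of a] by (simp add: algebra_simps)
  moreover have "Moebius_function \<theta> a = (\<lambda>z. cis \<theta> * (z - a) / (1 - cnj a * z))"
    by (auto simp: Moebius_function_def cis_conv_exp)
  ultimately show ?thesis by (simp add: power2_eq_square)
qed

text \<open>The equality case of the Schwarz-Pick lemma, squared. In this form it is a statement
  about area densities; it serves once to transform \<open>vol_H\<close> and once to compare
  conformal factors.\<close>

lemma moebius_disk_derivative:
  assumes "m \<in> moebius_disk" "z \<in> disk"
  shows "(norm (deriv m z))\<^sup>2 / (1 - (norm (m z))\<^sup>2)\<^sup>2 = 1 / (1 - (norm z)\<^sup>2)\<^sup>2"
proof -
  obtain \<theta> a where m: "m = Moebius_function \<theta> a" and a: "a \<in> disk"
    using assms(1) unfolding moebius_disk_def by auto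
  have nz: "norm (1 - cnj a * z) \<noteq> 0" using one_minus_cnj_mult_nonzero[OF a assms(2)] by simp
  have pos: "1 - (norm a)\<^sup>2 > 0" "1 - (norm z)\<^sup>2 > 0"
    using a assms(2) by (auto simp: abs_square_less_1)
  have "deriv m z = cis \<theta> * (1 - (norm a)\<^sup>2) / (1 - cnj a * z)\<^sup>2"
    using Moebius_function_has_field_derivative[OF a assms(2)] unfolding m by (rule DERIV_imp_deriv)
  moreover have "norm (1 - (complex_of_real (norm a))\<^sup>2) = 1 - (norm a)\<^sup>2"
    using pos(1) by (metis abs_of_pos norm_of_real of_real_1 of_real_diff of_real_power)
  ultimately have d: "norm (deriv m z) = (1 - (norm a)\<^sup>2) / (norm (1 - cnj a * z))\<^sup>2"
    by (simp add: norm_mult norm_divide norm_power)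
  show ?thesis
    unfolding d unfolding m norm_Moebius_function_sq[OF a assms(2)]
    using nz pos by (simp add: power_divide power_mult_distrib)
qed

text \<open>This quotient is the pseudo-hyperbolic distance. One minus its square is, by
  \<open>norm_Moebius_function_sq\<close>, an expression in quantities that \<open>m\<close>
  multiplies by explicit factors, and these factors cancel.\<close>

lemma moebius_disk_pseudo_dist:
  assumes "m \<in> moebius_disk" "z \<in> disk" "w \<in> disk"
  shows "norm ((m z - m w) / (1 - cnj (m w) * m z)) = norm ((z - w) / (1 - cnj w * z))"
proof -
  obtain \<theta> a where m: "m = Moebius_function \<theta> a" and a: "a \<in> disk"
    using assms(1) unfolding moebius_disk_def by auto
  have eq: "norm ((z - w) / (1 - cnj w * z)) = norm (Moebius_function 0 w z)" for z w
    by (simp add: Moebius_function_def)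
  have *: "1 - (norm (Moebius_function 0 w z))\<^sup>2 = (1 - (norm (Moebius_function 0 (m w) (m z)))\<^sup>2)"
  proof -
    have nz: "norm (1 - cnj a * z) \<noteq> 0" "norm (1 - cnj a * w) \<noteq> 0" "norm (1 - cnj w * z) \<noteq> 0"
      using one_minus_cnj_mult_nonzero a assms(2,3) by auto
    have nzc: "1 - cnj a * z \<noteq> 0" "1 - cnj a * w \<noteq> 0" "1 - a * cnj w \<noteq> 0"
      using one_minus_cnj_mult_nonzero[OF a] one_minus_cnj_mult_nonzero[OF assms(3) a] assms(2,3)
      by (auto simp: mult.commute)
    have cc: "cis \<theta> * cnj (cis \<theta>) = 1" by (simp add: cis_cnj cis_mult)
    have "1 - cnj (m w) * m z = 1 - (cis \<theta> * cnj (cis \<theta>)) * ((cnj w - cnj a) * (z - a) / ((1 - a * cnj w) * (1 - cnj a * z)))"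
      by (simp add: m Moebius_function_def cis_conv_exp[symmetric])
    also have "\<dots> = (1 - cnj a * a) * (1 - cnj w * z) / ((1 - a * cnj w) * (1 - cnj a * z))"
    proof -
      have "(1 - a * cnj w) * (1 - cnj a * z) - (cnj w - cnj a) * (z - a) = (1 - cnj a * a) * (1 - cnj w * z)"
        by (simp add: algebra_simps)
      moreover have "1 - 1 * (N / D) = (D - N) / D" if "D \<noteq> 0" for N D :: complex
        using that by (simp add: diff_divide_distrib)
      ultimately show ?thesis unfolding cc using nzc by simp
    qed
    finally have e3: "norm (1 - cnj (m w) * m z) = (1 - (norm a)\<^sup>2) * norm (1 - cnj w * z) / (norm (1 - cnj a * w) * norm (1 - cnj a * z))"
    proof -
      assume e: "1 - cnj (m w) * m z = (1 - cnj a * a) * (1 - cnj w * z) / ((1 - a * cnj w) * (1 - cnj a * z))"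
      have "norm (1 - cnj a * a) = 1 - (norm a)\<^sup>2"
      proof -
        have "1 - cnj a * a = of_real (1 - (norm a)\<^sup>2)" using complex_norm_square[of a] by (simp add: mult.commute)
        moreover have "1 - (norm a)\<^sup>2 > 0" using a by (auto simp: abs_square_less_1)
        ultimately show ?thesis by (metis abs_of_pos norm_of_real)
      qed
      moreover have "norm (1 - a * cnj w) = norm (1 - cnj a * w)"
        by (metis complex_cnj_cnj complex_cnj_diff complex_cnj_mult complex_cnj_one complex_mod_cnj)
      ultimately show ?thesis unfolding e by (simp add: norm_mult norm_divide)
    qed
    have mzw: "m w \<in> disk" "m z \<in> disk" using assms moebius_disk_mem by blast+
    have p: "1 - (norm a)\<^sup>2 \<noteq> 0" using a by (auto simp: abs_square_less_1 abs_square_eq_1)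
    \<comment> \<open>Here \<open>p\<close>, \<open>e\<close>, \<open>d\<close> stand for
      \<open>1 - (norm a)\<^sup>2\<close>, \<open>norm (1 - cnj a * w)\<close>,
      \<open>norm (1 - cnj a * z)\<close>, the factors that \<open>m\<close> introduces.\<close>
    have gen: "W * Z / q\<^sup>2 = (p * W / e\<^sup>2) * (p * Z / d\<^sup>2) / (p * q / (e * d))\<^sup>2"
      if "p \<noteq> 0" "e \<noteq> 0" "d \<noteq> 0" for p W Z d e q :: real
      using that by (simp add: divide_simps power2_eq_square)
    have "1 - (norm (Moebius_function 0 w z))\<^sup>2 = (1 - (norm w)\<^sup>2) * (1 - (norm z)\<^sup>2) / (norm (1 - cnj w * z))\<^sup>2"
      using assms by (intro norm_Moebius_function_sq)
    also have "\<dots> = (1 - (norm (m w))\<^sup>2) * (1 - (norm (m z))\<^sup>2) / (norm (1 - cnj (m w) * m z))\<^sup>2"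
      unfolding e3 unfolding m norm_Moebius_function_sq[OF a assms(2)] norm_Moebius_function_sq[OF a assms(3)]
      by (rule gen[OF p nz(2,1)])
    also have "\<dots> = 1 - (norm (Moebius_function 0 (m w) (m z)))\<^sup>2"
      using mzw by (intro norm_Moebius_function_sq[symmetric])
    finally show ?thesis .
  qed
  have "(norm (Moebius_function 0 w z))\<^sup>2 = (norm (Moebius_function 0 (m w) (m z)))\<^sup>2" using * by linarith
  then have "norm (Moebius_function 0 w z) = norm (Moebius_function 0 (m w) (m z))"
    by (simp add: power2_eq_iff_nonneg)
  then show ?thesis by (simp add: eq)
qed

lemma moebius_disk_geodesic_disk:
  assumes "m \<in> moebius_disk" "z \<in> disk" "w \<in> disk"
  shows "m z \<in> geodesic_disk (m w) R \<longleftrightarrow> z \<in> geodesic_disk w R"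
  using assms moebius_disk_pseudo_dist[OF assms] moebius_disk_mem[OF assms(1,2)]
  by (simp add: geodesic_disk_def)

section \<open>Invariance of the hyperbolic area\<close>

text \<open>The change of variables theorem \<open>measure_differentiable_image_eq\<close> concerns
  maps of \<open>real^'n\<close>; the two coordinate isomorphisms carry it over to
  \<open>complex\<close>.\<close>

definition complex_of_vec :: "real^2 \<Rightarrow> complex" where
  "complex_of_vec v = Complex (v$1) (v$2)"

definition vec_of_complex :: "complex \<Rightarrow> real^2" where
  "vec_of_complex z = vector [Re z, Im z]"

lemma complex_of_vec_of_complex [simp]: "complex_of_vec (vec_of_complex z) = z"
  by (simp add: complex_of_vec_def vec_of_complex_def)

lemma vec_of_complex_of_vec [simp]: "vec_of_complex (complex_of_vec v) = v"
  by (simp add: complex_of_vec_def vec_of_complex_def vec_eq_iff forall_2)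

lemma linear_complex_of_vec: "linear complex_of_vec"
  by (rule linearI) (auto simp: complex_of_vec_def complex_eq_iff)

lemma linear_vec_of_complex: "linear vec_of_complex"
  by (rule linearI) (auto simp: vec_of_complex_def vec_eq_iff forall_2)

lemma borel_measurable_complex_of_vec [measurable]: "complex_of_vec \<in> borel \<rightarrow>\<^sub>M borel"
  using linear_complex_of_vec
  by (intro borel_measurable_continuous_onI linear_continuous_on) (simp add: linear_conv_bounded_linear)

text \<open>A Borel measure that gives every box its volume is \<open>lborel\<close>, and
  coordinates turn a box of the plane into a box of \<open>real^2\<close> with the same side
  lengths.\<close>

lemma distr_lborel_complex_of_vec: "distr lborel borel complex_of_vec = (lborel :: complex measure)"
proof (rule lborel_eqI[symmetric])
  fix l u :: complex
  assume le: "\<And>b. b \<in> Basis \<Longrightarrow> l \<bullet> b \<le> u \<bullet> b"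
  have "complex_of_vec -` box l u = box (vec_of_complex l) (vec_of_complex u)"
    by (auto simp: in_box_complex_iff mem_box_cart complex_of_vec_def vec_of_complex_def forall_2)
  then have "emeasure (distr lborel borel complex_of_vec) (box l u) = emeasure lborel (box (vec_of_complex l) (vec_of_complex u))"
    by (simp add: emeasure_distr)
  also have "\<dots> = (\<Prod>b\<in>Basis. (vec_of_complex u - vec_of_complex l) \<bullet> b)"
  proof (intro emeasure_lborel_box)
    have "\<forall>i. vec_of_complex l $ i \<le> vec_of_complex u $ i"
      using le[of 1] le[of \<i>] by (auto simp: vec_of_complex_def Basis_complex_def forall_2)
    then show "vec_of_complex l \<bullet> b \<le> vec_of_complex u \<bullet> b" if "b \<in> Basis" for b
      using that by (auto simp: Basis_vec_def inner_axis)
  qed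
  also have "(\<Prod>b\<in>Basis. (vec_of_complex u - vec_of_complex l) \<bullet> b) = (\<Prod>i\<in>UNIV. (vec_of_complex u - vec_of_complex l) $ i)"
  proof -
    have "(Basis :: (real^2) set) = (\<lambda>i. axis i 1) ` UNIV" by (auto simp: Basis_vec_def)
    moreover have "inj (\<lambda>i::2. axis i (1::real))" by (auto simp: inj_on_def axis_eq_axis)
    ultimately show ?thesis
      by (elim ssubst, subst prod.reindex) (simp_all add: inner_axis)
  qed
  also have "\<dots> = (\<Prod>b\<in>Basis. (u - l) \<bullet> b)"
    by (simp add: UNIV_2 vec_of_complex_def Basis_complex_def)
  finally show "emeasure (distr lborel borel complex_of_vec) (box l u) = ennreal (\<Prod>b\<in>Basis. (u - l) \<bullet> b)" .
qed simp

lemma det_complex_mult: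
  "det (matrix (\<lambda>v. vec_of_complex (c * complex_of_vec v))) = (norm c)\<^sup>2"
  unfolding cmod_power2
  by (simp add: det_2 matrix_def vec_of_complex_def complex_of_vec_def axis_def power2_eq_square)

text \<open>Multiplication by \<open>deriv f z\<close> has determinant
  \<open>(norm (deriv f z))\<^sup>2\<close>, so this is the real change of variables formula.
  Finiteness enters because that formula speaks of real-valued integrals and of sets of finite
  measure.\<close>

lemma emeasure_holomorphic_image_finite:
  fixes f :: "complex \<Rightarrow> complex"
  assumes f: "f holomorphic_on S" "open S" "inj_on f S"
    and A: "A \<in> sets borel" "A \<subseteq> S" and fA: "f ` A \<in> sets borel"
    and fin: "(\<integral>\<^sup>+z\<in>A. ennreal ((norm (deriv f z))\<^sup>2) \<partial>lborel) < \<infinity>"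
  shows "emeasure lborel (f ` A) = (\<integral>\<^sup>+z\<in>A. ennreal ((norm (deriv f z))\<^sup>2) \<partial>lborel)"
proof -
  define g where "g = (\<lambda>v. vec_of_complex (f (complex_of_vec v)))"
  define g' where "g' = (\<lambda>x v. vec_of_complex (deriv f (complex_of_vec x) * complex_of_vec v))"
  define A' where "A' = complex_of_vec -` A"
  define J where "J = (\<lambda>z. indicator A z * (norm (deriv f z))\<^sup>2)"
  have contd: "continuous_on S (deriv f)"
    using f by (intro holomorphic_on_imp_continuous_on holomorphic_deriv)
  have J[measurable]: "J \<in> borel_measurable borel"
  proof -
    have "(\<lambda>z. indicator A z *\<^sub>R (norm (deriv f z))\<^sup>2) \<in> borel_measurable borel"
      using A f by (intro borel_measurable_continuous_on_indicator continuous_intros continuous_on_subset[OF contd])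
    then show ?thesis by (simp add: J_def)
  qed
  have Jint: "(\<integral>\<^sup>+z\<in>A. ennreal ((norm (deriv f z))\<^sup>2) \<partial>lborel) = (\<integral>\<^sup>+z. ennreal (J z) \<partial>lborel)"
    by (intro nn_integral_cong) (auto simp: J_def indicator_def)
  have Jint': "(\<integral>\<^sup>+z. ennreal (J z) \<partial>lborel) = (\<integral>\<^sup>+x. ennreal (J (complex_of_vec x)) \<partial>lborel)"
    by (subst distr_lborel_complex_of_vec[symmetric], subst nn_integral_distr) auto
  then obtain r where r: "r \<ge> 0" "(\<integral>\<^sup>+x. ennreal (J (complex_of_vec x)) \<partial>lborel) = ennreal r"
    using fin Jint by (metis ennreal_cases infinity_ennreal_def less_irrefl)
  have A'[measurable]: "A' \<in> sets borel"
    unfolding A'_def using measurable_sets[OF borel_measurable_complex_of_vec A(1)] by simp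
  have "((\<lambda>x. J (complex_of_vec x)) has_integral r) UNIV"
  proof (rule nn_integral_has_integral)
    show "0 \<le> J (complex_of_vec x)" for x by (simp add: J_def)
  qed (use r in auto)
  moreover have "J (complex_of_vec x) = (if x \<in> A' then \<bar>det (matrix (g' x))\<bar> else 0)" for x
    by (simp add: J_def A'_def g'_def det_complex_mult)
  ultimately have hi: "((\<lambda>x. \<bar>det (matrix (g' x))\<bar>) has_integral r) A'"
    by (simp add: has_integral_restrict_UNIV)
  have der: "(g has_derivative g' x) (at x within A')" if "x \<in> A'" for x
  proof -
    have "complex_of_vec x \<in> S" using that A by (auto simp: A'_def)
    then have "(f has_field_derivative deriv f (complex_of_vec x)) (at (complex_of_vec x))"
      using f holomorphic_derivI by blast
    then have "(f has_derivative (\<lambda>h. deriv f (complex_of_vec x) * h)) (at (complex_of_vec x))"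
      by (simp add: has_field_derivative_def)
    then have "((f \<circ> complex_of_vec) has_derivative ((\<lambda>h. deriv f (complex_of_vec x) * h) \<circ> complex_of_vec)) (at x)"
      by (rule diff_chain_at[OF linear_imp_has_derivative[OF linear_complex_of_vec]])
    then have "((vec_of_complex \<circ> (f \<circ> complex_of_vec)) has_derivative
        (vec_of_complex \<circ> ((\<lambda>h. deriv f (complex_of_vec x) * h) \<circ> complex_of_vec))) (at x)"
      by (rule diff_chain_at[OF _ linear_imp_has_derivative[OF linear_vec_of_complex]])
    then show ?thesis
      unfolding g_def g'_def o_def by (rule has_derivative_at_withinI)
  qed
  have inj: "inj_on g A'"
    using f(3) A(2) unfolding inj_on_def g_def A'_def
    by (metis complex_of_vec_of_complex subsetD vec_of_complex_of_vec vimageE)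
  have A'l: "A' \<in> sets lebesgue" by simp
  have lm: "g ` A' \<in> lmeasurable"
    using measurable_differentiable_image_eq[OF A'l der inj] hi by blast
  have ms: "measure lebesgue (g ` A') = r"
    using measure_differentiable_image_eq[OF A'l der inj] hi by (simp add: has_integral_iff)
  have img: "complex_of_vec -` (f ` A) = g ` A'"
  proof (intro set_eqI iffI)
    fix x assume "x \<in> complex_of_vec -` (f ` A)"
    then obtain a where "a \<in> A" "complex_of_vec x = f a" by auto
    then show "x \<in> g ` A'"
      by (intro image_eqI[of _ _ "vec_of_complex a"]) (auto simp: g_def A'_def simp flip: \<open>complex_of_vec x = f a\<close>)
  qed (auto simp: g_def A'_def)
  have gb: "g ` A' \<in> sets borel"
    using measurable_sets[OF borel_measurable_complex_of_vec fA] img by simp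
  have "emeasure lborel (f ` A) = emeasure lborel (g ` A')"
    using fA img by (subst distr_lborel_complex_of_vec[symmetric], subst emeasure_distr) auto
  also have "\<dots> = emeasure lebesgue (g ` A')"
    using gb by simp
  also have "\<dots> = ennreal r"
    using lm ms by (metis emeasure_eq_measure2)
  finally show ?thesis using r Jint Jint' by simp
qed

text \<open>Reduction to the finite case: \<open>A\<close> is exhausted by the sets
  \<open>B n\<close>, on which \<open>norm z\<close> and the Jacobian are at most \<open>n\<close>,
  and both sides pass to the limit by monotone convergence. Images of Borel subsets of
  \<open>A\<close> are assumed Borel because the finite case is applied to each
  \<open>B n\<close>.\<close>

lemma emeasure_holomorphic_image:
  fixes f :: "complex \<Rightarrow> complex"
  assumes f: "f holomorphic_on S" "open S" "inj_on f S"
    and A: "A \<in> sets borel" "A \<subseteq> S" and fA: "\<And>B. B \<in> sets borel \<Longrightarrow> B \<subseteq> A \<Longrightarrow> f ` B \<in> sets borel"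
  shows "emeasure lborel (f ` A) = (\<integral>\<^sup>+z\<in>A. ennreal ((norm (deriv f z))\<^sup>2) \<partial>lborel)"
proof -
  have contd: "continuous_on S (deriv f)"
    using f by (intro holomorphic_on_imp_continuous_on holomorphic_deriv)
  define J where "J = (\<lambda>z. indicator S z * (norm (deriv f z))\<^sup>2)"
  have J[measurable]: "J \<in> borel_measurable borel"
  proof -
    have "(\<lambda>z. indicator S z *\<^sub>R (norm (deriv f z))\<^sup>2) \<in> borel_measurable borel"
      using f by (intro borel_measurable_continuous_on_indicator continuous_intros contd) auto
    then show ?thesis by (simp add: J_def)
  qed
  define B where "B n = {z \<in> A. norm z \<le> real n \<and> J z \<le> real n}" for n
  have B[measurable]: "B n \<in> sets borel" for n
  proof -
    have "{z \<in> space borel. z \<in> A \<and> norm z \<le> real n \<and> J z \<le> real n} \<in> sets borel"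
      using A(1) by measurable
    then show ?thesis by (simp add: B_def)
  qed
  have incB: "incseq B" unfolding B_def incseq_def le_fun_def by auto
  have UB: "(\<Union>n. B n) = A"
  proof -
    have "\<exists>n. norm z \<le> real n \<and> J z \<le> real n" for z
    proof -
      obtain n where "max (norm z) (J z) \<le> real n" using real_arch_simple by blast
      then show ?thesis by auto
    qed
    then show ?thesis by (auto simp: B_def)
  qed
  have BA: "B n \<subseteq> A" for n by (auto simp: B_def)
  have eq: "emeasure lborel (f ` B n) = (\<integral>\<^sup>+z\<in>B n. ennreal ((norm (deriv f z))\<^sup>2) \<partial>lborel)" for n
  proof (rule emeasure_holomorphic_image_finite[OF f B])
    show "B n \<subseteq> S" "f ` B n \<in> sets borel" using BA A fA B by blast+
    have "(\<integral>\<^sup>+z\<in>B n. ennreal ((norm (deriv f z))\<^sup>2) \<partial>lborel) \<le> (\<integral>\<^sup>+z. ennreal (real n) * indicator (cball (0::complex) (real n)) z \<partial>lborel)"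
    proof (rule nn_integral_mono)
      show "ennreal ((norm (deriv f z))\<^sup>2) * indicator (B n) z \<le> ennreal (real n) * indicator (cball (0::complex) (real n)) z" for z
        using A(2) by (cases "z \<in> B n") (auto simp: B_def J_def subset_iff)
    qed
    also have "\<dots> = ennreal (real n) * emeasure lborel (cball (0::complex) (real n))"
      by (subst nn_integral_cmult) (auto intro!: borel_measurable_indicator)
    also have "\<dots> < \<infinity>"
      using emeasure_bounded_finite[of "cball (0::complex) (real n)"] by (simp add: ennreal_mult_less_top)
    finally show "(\<integral>\<^sup>+z\<in>B n. ennreal ((norm (deriv f z))\<^sup>2) \<partial>lborel) < \<infinity>" .
  qed
  have "emeasure lborel (f ` A) = (SUP n. emeasure lborel (f ` B n))"
  proof -
    have "incseq (\<lambda>n. f ` B n)" using incB unfolding incseq_def le_fun_def by (auto intro: image_mono)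
    moreover have "range (\<lambda>n. f ` B n) \<subseteq> sets lborel" using fA B BA by auto
    ultimately have "(SUP n. emeasure lborel (f ` B n)) = emeasure lborel (\<Union>n. f ` B n)"
      by (rule SUP_emeasure_incseq[rotated])
    then show ?thesis by (simp add: UB flip: image_UN)
  qed
  also have "\<dots> = (SUP n. \<integral>\<^sup>+z. ennreal (J z) * indicator (B n) z \<partial>lborel)"
    unfolding eq using A(2) BA by (intro SUP_cong nn_integral_cong refl) (auto simp: indicator_def J_def)
  also have "\<dots> = (\<integral>\<^sup>+z. (SUP n. ennreal (J z) * indicator (B n) z) \<partial>lborel)"
    using incB by (intro nn_integral_monotone_convergence_SUP[symmetric])
       (auto simp: incseq_def le_fun_def indicator_def intro!: mult_left_mono)
  also have "\<dots> = (\<integral>\<^sup>+z\<in>A. ennreal ((norm (deriv f z))\<^sup>2) \<partial>lborel)"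
  proof (intro nn_integral_cong)
    fix z
    have "(SUP n. ennreal (J z) * indicator (B n) z) = ennreal (J z) * indicator A z"
    proof -
      have "(SUP n. indicator (B n) z :: ennreal) = indicator A z"
      proof (cases "z \<in> A")
        case True
        then obtain n where "z \<in> B n" using UB by auto
        then show ?thesis using True by (intro antisym SUP_least SUP_upper2[of n]) (auto simp: indicator_def)
      next
        case False
        then have "z \<notin> B n" for n using BA by blast
        then show ?thesis using False by simp
      qed
      then show ?thesis by (subst SUP_mult_left_ennreal[symmetric]) simp
    qed
    then show "(SUP n. ennreal (J z) * indicator (B n) z) = ennreal ((norm (deriv f z))\<^sup>2) * indicator A z"
      using A(2) by (auto simp: J_def indicator_def)
  qed
  finally show ?thesis .
qed

section \<open>The measure space of the hyperbolic area\<close>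

lemma space_vol_H [simp]: "space vol_H = disk"
  by (simp add: vol_H_def space_restrict_space)

lemma sets_vol_H [measurable_cong]: "sets vol_H = sets (restrict_space borel disk)"
  by (simp add: vol_H_def sets_restrict_space)

lemma borel_measurable_vol_H_continuous:
  assumes "continuous_on disk f"
  shows "f \<in> borel_measurable vol_H"
  unfolding measurable_cong_sets[OF sets_vol_H refl] by (rule borel_measurable_continuous_on_restrict[OF assms])

lemma borel_measurable_vol_H_borel:
  assumes "f \<in> borel_measurable borel"
  shows "f \<in> borel_measurable vol_H"
  unfolding measurable_cong_sets[OF sets_vol_H refl] by (rule measurable_restrict_space1[OF assms])

lemma measurable_vol_H_continuous:
  assumes "continuous_on disk f" "f \<in> disk \<rightarrow> disk"
  shows "f \<in> measurable vol_H vol_H"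
proof -
  have "f \<in> measurable vol_H (restrict_space borel disk)"
    using assms by (intro measurable_restrict_space2 borel_measurable_vol_H_continuous) auto
  then show ?thesis by (simp only: measurable_cong_sets[OF refl sets_vol_H])
qed

lemma moebius_disk_measurable: "m \<in> moebius_disk \<Longrightarrow> m \<in> measurable vol_H vol_H"
  by (intro measurable_vol_H_continuous moebius_disk_continuous Pi_I) (use moebius_disk_mem in blast)+

lemma nn_integral_vol_H:
  assumes f: "f \<in> borel_measurable vol_H"
  shows "(\<integral>\<^sup>+z. f z \<partial>vol_H) = (\<integral>\<^sup>+z. ennreal (1 / (1 - (norm z)\<^sup>2)\<^sup>2) * f z \<partial>(restrict_space lborel disk))"
proof -
  have eq: "sets vol_H = sets (restrict_space lborel disk)" by (simp add: vol_H_def)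
  have "f \<in> borel_measurable (restrict_space lborel disk)"
    using f by (simp only: measurable_cong_sets[OF eq refl])
  moreover have "(\<lambda>z::complex. ennreal (1 / (1 - (norm z)\<^sup>2)\<^sup>2)) \<in> borel_measurable (restrict_space lborel disk)"
    by (rule measurable_restrict_space1) measurable
  ultimately show ?thesis
    unfolding vol_H_def by (rule nn_integral_density[rotated])
qed

text \<open>The image under \<open>m\<close> is the preimage under the inverse of \<open>m\<close>,
  which is continuous on the disk.\<close>

lemma moebius_disk_image_measurable:
  assumes "m \<in> moebius_disk" "B \<in> sets borel" "B \<subseteq> disk"
  shows "m ` B \<in> sets borel"
proof -
  obtain n where n: "n \<in> moebius_disk" "\<And>z. z \<in> disk \<Longrightarrow> n (m z) = z" "\<And>z. z \<in> disk \<Longrightarrow> m (n z) = z"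
    using moebius_disk_inverse[OF assms(1)] by blast
  have "m ` B = n -` B \<inter> disk"
  proof (intro set_eqI iffI)
    fix z assume "z \<in> m ` B"
    then show "z \<in> n -` B \<inter> disk" using n assms(3) moebius_disk_mem[OF assms(1)] by fastforce
  next
    fix z assume "z \<in> n -` B \<inter> disk"
    then show "z \<in> m ` B" using n(3)[of z] by (metis IntD1 IntD2 image_eqI vimageD)
  qed
  moreover have "B \<in> sets vol_H"
    using assms by (auto simp: sets_vol_H sets_restrict_space)
  then have "n -` B \<inter> disk \<in> sets vol_H"
    using measurable_sets[OF moebius_disk_measurable[OF n(1)]] by simp
  then have "n -` B \<inter> disk \<in> sets borel"
    by (auto simp: sets_vol_H sets_restrict_space)
  ultimately show ?thesis by simp
qed

lemma borel_measurable_moebius_disk_deriv: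
  assumes "m \<in> moebius_disk"
  shows "(\<lambda>z. ennreal ((norm (deriv m z))\<^sup>2)) \<in> borel_measurable (restrict_space lborel disk)"
proof -
  have eq: "sets vol_H = sets (restrict_space lborel disk)" by (simp add: vol_H_def)
  have "continuous_on disk (deriv m)"
    by (intro holomorphic_on_imp_continuous_on holomorphic_deriv moebius_disk_holomorphic assms open_ball)
  then have "(\<lambda>z. (norm (deriv m z))\<^sup>2) \<in> borel_measurable vol_H"
    by (intro borel_measurable_vol_H_continuous continuous_intros)
  then have "(\<lambda>z. (norm (deriv m z))\<^sup>2) \<in> borel_measurable (restrict_space lborel disk)"
    by (simp only: measurable_cong_sets[OF eq refl])
  then show ?thesis by measurable
qed

text \<open>The change of variables formula as an identity of measures; in this form it transforms
  integrals of arbitrary nonnegative measurable functions.\<close>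

lemma distr_lborel_moebius_disk:
  assumes m: "m \<in> moebius_disk"
  defines "D \<equiv> restrict_space lborel disk"
  shows "distr (density D (\<lambda>z. ennreal ((norm (deriv m z))\<^sup>2))) D m = D"
proof (rule measure_eqI)
  have setsD: "sets D = sets vol_H" by (simp add: D_def vol_H_def)
  have spaceD: "space D = disk" by (simp add: D_def space_restrict_space)
  have mD: "m \<in> measurable D D"
    using moebius_disk_measurable[OF m] by (simp only: measurable_cong_sets[OF setsD setsD])
  have dm: "(\<lambda>z. ennreal ((norm (deriv m z))\<^sup>2)) \<in> borel_measurable D"
    unfolding D_def by (rule borel_measurable_moebius_disk_deriv[OF m])
  fix C assume "C \<in> sets (distr (density D (\<lambda>z. ennreal ((norm (deriv m z))\<^sup>2))) D m)"
  then have C: "C \<in> sets D" by simp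
  then have Cb: "C \<in> sets borel" "C \<subseteq> disk"
    by (auto simp: setsD sets_vol_H sets_restrict_space)
  define B where "B = m -` C \<inter> disk"
  have B: "B \<in> sets D" using measurable_sets[OF mD C] by (simp add: B_def spaceD)
  then have Bb: "B \<in> sets borel" "B \<subseteq> disk"
    by (auto simp: setsD sets_vol_H sets_restrict_space)
  have mB: "m ` B = C"
  proof -
    have "m ` disk = disk" using moebius_disk_bij[OF m] by (rule bij_betw_imp_surj_on)
    then have "C \<subseteq> m ` disk" using Cb by simp
    then show ?thesis unfolding B_def by (auto simp del: mem_ball_0)
  qed
  have "emeasure (distr (density D (\<lambda>z. ennreal ((norm (deriv m z))\<^sup>2))) D m) C
     = (\<integral>\<^sup>+z\<in>B. ennreal ((norm (deriv m z))\<^sup>2) \<partial>D)"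
    using mD C B dm by (simp add: emeasure_distr emeasure_density spaceD B_def)
  also have "\<dots> = (\<integral>\<^sup>+z\<in>B. ennreal ((norm (deriv m z))\<^sup>2) \<partial>lborel)"
    unfolding D_def using Bb
    by (subst nn_integral_restrict_space) (auto intro!: nn_integral_cong simp: indicator_def subset_iff)
  also have "\<dots> = emeasure lborel C"
    unfolding mB[symmetric]
  proof (rule emeasure_holomorphic_image[OF moebius_disk_holomorphic[OF m] open_ball _ Bb, symmetric])
    show "inj_on m disk" using moebius_disk_bij[OF m] by (rule bij_betw_imp_inj_on)
    show "m ` X \<in> sets borel" if "X \<in> sets borel" "X \<subseteq> B" for X
      using that Bb(2) by (intro moebius_disk_image_measurable[OF m]) auto
  qed
  also have "\<dots> = emeasure D C"
    unfolding D_def using Cb by (subst emeasure_restrict_space) auto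
  finally show "emeasure (distr (density D (\<lambda>z. ennreal ((norm (deriv m z))\<^sup>2))) D m) C = emeasure D C" .
qed (simp only: sets_distr)

lemma distr_vol_H_moebius_disk:
  assumes m: "m \<in> moebius_disk"
  shows "distr vol_H vol_H m = vol_H"
proof (rule measure_eqI)
  define D where "D = restrict_space lborel disk"
  define h where "h = (\<lambda>z::complex. ennreal (1 / (1 - (norm z)\<^sup>2)\<^sup>2))"
  define j where "j = (\<lambda>z. ennreal ((norm (deriv m z))\<^sup>2))"
  have setsD: "sets D = sets vol_H" by (simp add: D_def vol_H_def)
  have spaceD: "space D = disk" by (simp add: D_def space_restrict_space)
  have mD[measurable]: "m \<in> measurable D D"
    using moebius_disk_measurable[OF m] by (simp only: measurable_cong_sets[OF setsD setsD])
  have hD[measurable]: "h \<in> borel_measurable D"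
    unfolding h_def D_def by (rule measurable_restrict_space1) measurable
  have dm[measurable]: "j \<in> borel_measurable D"
    unfolding j_def D_def by (rule borel_measurable_moebius_disk_deriv[OF m])
  fix A assume "A \<in> sets (distr vol_H vol_H m)"
  then have A: "A \<in> sets vol_H" by simp
  then have AD[measurable]: "A \<in> sets D" by (simp add: setsD)
  have inv: "distr (density D j) D m = D"
    unfolding D_def j_def by (rule distr_lborel_moebius_disk[OF m])
  have pre: "m -` A \<inter> disk \<in> sets vol_H"
    using measurable_sets[OF moebius_disk_measurable[OF m] A] by simp
  have "emeasure vol_H A = (\<integral>\<^sup>+z. indicator A z \<partial>vol_H)"
    using A by simp
  also have "\<dots> = (\<integral>\<^sup>+z. h z * indicator A z \<partial>D)"
    unfolding h_def D_def using A by (intro nn_integral_vol_H) auto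
  also have "\<dots> = (\<integral>\<^sup>+z. h z * indicator A z \<partial>(distr (density D j) D m))"
    by (simp only: inv)
  also have "\<dots> = (\<integral>\<^sup>+z. h (m z) * indicator A (m z) \<partial>(density D j))"
    by (subst nn_integral_distr) auto
  also have "\<dots> = (\<integral>\<^sup>+z. j z * (h (m z) * indicator A (m z)) \<partial>D)"
    by (subst nn_integral_density) auto
  also have "\<dots> = (\<integral>\<^sup>+z. h z * indicator (m -` A \<inter> disk) z \<partial>D)"
  proof (intro nn_integral_cong)
    fix z assume "z \<in> space D"
    then have z: "z \<in> disk" by (simp only: spaceD)
    \<comment> \<open>The hyperbolic weight absorbs the Jacobian of \<open>m\<close>.\<close>
    have "j z * h (m z) = h z"
      unfolding j_def h_def using moebius_disk_derivative[OF m z]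
      by (simp flip: ennreal_mult)
    then show "j z * (h (m z) * indicator A (m z)) = h z * indicator (m -` A \<inter> disk) z"
      using z by (simp add: indicator_def mult.assoc[symmetric])
  qed
  also have "\<dots> = (\<integral>\<^sup>+z. indicator (m -` A \<inter> disk) z \<partial>vol_H)"
    unfolding h_def D_def using pre by (intro nn_integral_vol_H[symmetric]) auto
  also have "\<dots> = emeasure vol_H (m -` A \<inter> disk)" using pre by simp
  also have "\<dots> = emeasure (distr vol_H vol_H m) A"
    using moebius_disk_measurable[OF m] A by (simp add: emeasure_distr)
  finally show "emeasure (distr vol_H vol_H m) A = emeasure vol_H A" by simp
qed (simp only: sets_distr)

lemma integral_vol_H_moebius_disk:
  fixes f :: "complex \<Rightarrow> real"
  assumes "m \<in> moebius_disk" "f \<in> borel_measurable vol_H"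
  shows "(LINT z|vol_H. f (m z)) = (LINT z|vol_H. f z)"
  using integral_distr[OF moebius_disk_measurable[OF assms(1)] assms(2)]
  by (simp add: distr_vol_H_moebius_disk[OF assms(1)])

lemma integrable_vol_H_moebius_disk:
  fixes f :: "complex \<Rightarrow> real"
  assumes "m \<in> moebius_disk" "integrable vol_H f"
  shows "integrable vol_H (\<lambda>z. f (m z))"
  using integrable_distr[OF moebius_disk_measurable[OF assms(1)]] assms
  by (simp add: distr_vol_H_moebius_disk[OF assms(1)])

section \<open>Compact subsets of the disk and integrals depending on a parameter\<close>

lemma compact_imp_finite_vol_H:
  assumes "compact K" "K \<subseteq> disk"
  shows "emeasure vol_H K < \<infinity>"
proof (cases "K = {}")
  case False
  have Kb: "K \<in> sets borel" using assms(1) by (simp add: compact_imp_closed)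
  then have K: "K \<in> sets vol_H" using assms by (auto simp: sets_vol_H sets_restrict_space)
  have "1 - (norm z)\<^sup>2 \<noteq> 0" if "z \<in> K" for z
    using assms(2) that by (auto simp: abs_square_eq_1 subset_iff)
  then have "continuous_on K (\<lambda>z. 1 / (1 - (norm z)\<^sup>2)\<^sup>2)"
    by (intro continuous_intros) auto
  from continuous_attains_sup[OF assms(1) False this]
  obtain c where c: "\<And>z. z \<in> K \<Longrightarrow> 1 / (1 - (norm z)\<^sup>2)\<^sup>2 \<le> c" by blast
  have "emeasure vol_H K = (\<integral>\<^sup>+z. indicator K z \<partial>vol_H)" using K by simp
  also have "\<dots> = (\<integral>\<^sup>+z. ennreal (1 / (1 - (norm z)\<^sup>2)\<^sup>2) * indicator K z \<partial>(restrict_space lborel disk))"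
    using K by (intro nn_integral_vol_H) auto
  also have "\<dots> \<le> (\<integral>\<^sup>+z. ennreal c * indicator K z \<partial>(restrict_space lborel disk))"
    using c by (intro nn_integral_mono) (auto simp: indicator_def intro!: ennreal_leI)
  also have "\<dots> = ennreal c * emeasure (restrict_space lborel disk) K"
    using Kb assms(2) by (intro nn_integral_cmult_indicator) (auto simp: sets_restrict_space)
  also have "\<dots> = ennreal c * emeasure lborel K"
    using Kb assms(2) by (subst emeasure_restrict_space) auto
  also have "\<dots> < \<infinity>"
    using emeasure_bounded_finite[of K] assms(1) by (simp add: ennreal_mult_less_top compact_imp_bounded)
  finally show ?thesis .
qed simp

lemma continuous_on_integral_compact:
  fixes f :: "'a::heine_borel \<Rightarrow> complex \<Rightarrow> real"
  assumes K: "compact K" "K \<subseteq> disk" and f: "continuous_on (S \<times> K) (\<lambda>(x, z). f x z)"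
  shows "continuous_on S (\<lambda>x. LINT z:K|vol_H. f x z)"
proof (rule continuous_on_sequentiallyI)
  fix u :: "nat \<Rightarrow> 'a" and a
  assume u: "\<forall>n. u n \<in> S" "a \<in> S" "u \<longlonglongrightarrow> a"
  \<comment> \<open>A convergent sequence together with its limit is compact, so the integrand is
    bounded on \<open>C \<times> K\<close>; that bound is the dominating function.\<close>
  define C where "C = insert a (range u)"
  have "compact (C \<times> K)" "C \<times> K \<subseteq> S \<times> K"
    using u K compact_sequence_with_limit by (auto simp: C_def intro!: compact_Times)
  then have "bounded ((\<lambda>(x, z). f x z) ` (C \<times> K))"
    by (intro compact_imp_bounded compact_continuous_image continuous_on_subset[OF f])
  then obtain b where b: "\<And>x z. x \<in> C \<Longrightarrow> z \<in> K \<Longrightarrow> \<bar>f x z\<bar> \<le> b"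
    unfolding bounded_iff by (auto simp: C_def)
  have meas: "(\<lambda>z. indicator K z *\<^sub>R f x z) \<in> borel_measurable vol_H" if "x \<in> S" for x
  proof -
    have "continuous_on K (\<lambda>z. (x, z))" by (intro continuous_intros)
    then have "continuous_on K (\<lambda>z. case (x, z) of (x, z) \<Rightarrow> f x z)"
      using that by (intro continuous_on_compose2[OF f]) auto
    then have "continuous_on K (f x)" by simp
    then show ?thesis
      using K by (intro borel_measurable_vol_H_borel borel_measurable_continuous_on_indicator)
         (auto simp: compact_imp_closed)
  qed
  have Ks: "K \<in> sets vol_H"
    using K by (auto simp: sets_vol_H sets_restrict_space compact_imp_closed)
  show "(\<lambda>n. LINT z:K|vol_H. f (u n) z) \<longlonglongrightarrow> (LINT z:K|vol_H. f a z)"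
    unfolding set_lebesgue_integral_def
  proof (rule integral_dominated_convergence[where w="\<lambda>z. indicator K z *\<^sub>R b"])
    show "integrable vol_H (\<lambda>z. indicator K z *\<^sub>R b)"
      using compact_imp_finite_vol_H[OF K] Ks by (intro integrable_scaleR_left) auto
    show "AE z in vol_H. (\<lambda>n. indicator K z *\<^sub>R f (u n) z) \<longlonglongrightarrow> indicator K z *\<^sub>R f a z"
    proof (intro always_eventually allI)
      fix z
      show "(\<lambda>n. indicator K z *\<^sub>R f (u n) z) \<longlonglongrightarrow> indicator K z *\<^sub>R f a z"
      proof (cases "z \<in> K")
        case True
        have "(\<lambda>n. (u n, z)) \<longlonglongrightarrow> (a, z)" using u by (intro tendsto_intros)
        then have "(\<lambda>n. (\<lambda>(x, z). f x z) (u n, z)) \<longlonglongrightarrow> (\<lambda>(x, z). f x z) (a, z)"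
          using True u by (intro continuous_on_tendsto_compose[OF f]) auto
        then show ?thesis by (auto intro!: tendsto_intros)
      qed simp
    qed
    show "AE z in vol_H. norm (indicator K z *\<^sub>R f (u n) z) \<le> indicator K z *\<^sub>R b" for n
      using b by (auto simp: indicator_def C_def)
  qed (use meas u in auto)
qed

section \<open>The local cost\<close>

text \<open>Continuity, the order-zero part of smoothness, is what the semicontinuity of the local
  cost rests on. In this form stability under \<open>pushforward\<close> is a matter of composing
  continuous functions.\<close>

definition disk_density :: "(complex \<Rightarrow> real) \<Rightarrow> bool" where
  "disk_density \<mu> \<longleftrightarrow> continuous_on disk \<mu> \<and> (\<forall>z\<in>disk. \<mu> z > 0) \<and> has_bochner_integral vol_H \<mu> 1"

lemma hyperbolic_density_imp_disk_density: "hyperbolic_density \<mu> \<Longrightarrow> disk_density \<mu>"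
  unfolding hyperbolic_density_def disk_density_def smooth_on_def by (metis Ck_on.simps(1))

lemma disk_densityD:
  assumes "disk_density \<mu>"
  shows "continuous_on disk \<mu>" "\<And>z. z \<in> disk \<Longrightarrow> \<mu> z > 0" "integrable vol_H \<mu>" "(LINT z|vol_H. \<mu> z) = 1"
  using assms unfolding disk_density_def by (auto simp: has_bochner_integral_iff)

text \<open>The cost of one transformation, before the infimum. Symmetry and the triangle inequality
  already hold at this level, where the second point is determined as \<open>m z0\<close>.\<close>

definition displacement_cost :: "real \<Rightarrow> (complex \<Rightarrow> real) \<Rightarrow> (complex \<Rightarrow> real) \<Rightarrow> (complex \<Rightarrow> complex) \<Rightarrow> complex \<Rightarrow> real" where
  "displacement_cost R \<mu> \<nu> m z0 = (LINT z:geodesic_disk z0 R|vol_H. \<bar>\<mu> z - \<nu> (m z)\<bar>)"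

lemma local_cost_alt:
  "local_cost R \<mu> \<nu> z w = (INF m\<in>{m \<in> moebius_disk. m z = w}. displacement_cost R \<mu> \<nu> m z)"
  by (simp add: local_cost_def displacement_cost_def)

lemma geodesic_disk_0: "geodesic_disk 0 R = cball 0 (tanh R)"
  using tanh_real_lt_1[of R] by (auto simp: geodesic_disk_def)

text \<open>A transformation taking \<open>z\<close> to 0 reduces the claim to a Euclidean ball, the
  geodesic disk around 0.\<close>

lemma geodesic_disk_measurable:
  assumes "z \<in> disk"
  shows "geodesic_disk z R \<in> sets vol_H"
proof -
  obtain m where m: "m \<in> moebius_disk" "m z = 0"
    using moebius_disk_transitive[OF assms, of 0] by auto
  have "x \<in> geodesic_disk z R \<longleftrightarrow> m x \<in> geodesic_disk 0 R \<and> x \<in> disk" for x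
    using moebius_disk_geodesic_disk[OF m(1) _ assms, of x R] m(2) by (auto simp: geodesic_disk_def)
  then have "geodesic_disk z R = m -` geodesic_disk 0 R \<inter> space vol_H"
    by (simp only: set_eq_iff Int_iff vimage_eq space_vol_H) simp
  moreover have "geodesic_disk 0 R \<in> sets vol_H"
    using tanh_real_lt_1[of R] unfolding geodesic_disk_0
    by (auto simp: sets_vol_H sets_restrict_space intro!: image_eqI[of _ _ "cball 0 (tanh R)"])
  ultimately show ?thesis
    using measurable_sets[OF moebius_disk_measurable[OF m(1)]] by simp
qed

lemma integrable_difference:
  assumes "disk_density \<mu>" "disk_density \<nu>" "m \<in> moebius_disk"
  shows "integrable vol_H (\<lambda>z. \<bar>\<mu> z - \<nu> (m z)\<bar>)"
  by (rule integrable_abs[OF Bochner_Integration.integrable_diff[OF disk_densityD(3)[OF assms(1)]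
        integrable_vol_H_moebius_disk[OF assms(3) disk_densityD(3)[OF assms(2)]]]])

lemma set_integrable_difference:
  assumes "disk_density \<mu>" "disk_density \<nu>" "m \<in> moebius_disk" "z \<in> disk"
  shows "integrable vol_H (\<lambda>x. indicator (geodesic_disk z R) x * \<bar>\<mu> x - \<nu> (m x)\<bar>)"
  using integrable_mult_indicator[OF geodesic_disk_measurable[OF assms(4)] integrable_difference[OF assms(1-3)]]
  by simp

lemma displacement_cost_nonneg: "0 \<le> displacement_cost R \<mu> \<nu> m z"
  unfolding displacement_cost_def set_lebesgue_integral_def by (rule Bochner_Integration.integral_nonneg) simp

text \<open>The 2 is the sum of the masses of \<open>\<mu>\<close> and of
  \<open>\<nu> \<circ> m\<close>; the latter is 1 because \<open>m\<close> preserves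
  \<open>vol_H\<close>.\<close>

lemma displacement_cost_le_2:
  assumes "disk_density \<mu>" "disk_density \<nu>" "m \<in> moebius_disk" "z \<in> disk"
  shows "displacement_cost R \<mu> \<nu> m z \<le> 2"
proof -
  have i: "integrable vol_H \<mu>" "integrable vol_H (\<lambda>x. \<nu> (m x))"
    using assms disk_densityD(3) integrable_vol_H_moebius_disk by blast+
  have "displacement_cost R \<mu> \<nu> m z \<le> (LINT x|vol_H. \<mu> x + \<nu> (m x))"
    unfolding displacement_cost_def set_lebesgue_integral_def real_scaleR_def
  proof (rule integral_mono[OF set_integrable_difference[OF assms]])
    show "integrable vol_H (\<lambda>x. \<mu> x + \<nu> (m x))" using i by simp
    fix x assume "x \<in> space vol_H"
    then have x: "x \<in> disk" by simp
    have "\<mu> x > 0" "\<nu> (m x) > 0"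
      using disk_densityD(2)[OF assms(1) x] disk_densityD(2)[OF assms(2) moebius_disk_mem[OF assms(3) x]] by auto
    then show "indicator (geodesic_disk z R) x * \<bar>\<mu> x - \<nu> (m x)\<bar> \<le> \<mu> x + \<nu> (m x)"
      by (auto simp: indicator_def)
  qed
  also have "\<dots> = (LINT x|vol_H. \<mu> x) + (LINT x|vol_H. \<nu> (m x))"
    by (rule Bochner_Integration.integral_add[OF i])
  also have "(LINT x|vol_H. \<nu> (m x)) = (LINT x|vol_H. \<nu> x)"
    using assms disk_densityD(3)[OF assms(2)] by (intro integral_vol_H_moebius_disk) auto
  finally show ?thesis using assms by (simp add: disk_densityD)
qed

text \<open>The substitution \<open>x \<mapsto> t x\<close> preserves \<open>vol_H\<close> and
  carries the geodesic disk around \<open>z\<close> to the one around \<open>t z\<close>. Symmetry,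
  the triangle inequality and the passage to a fixed domain of integration are all applications of
  it.\<close>

lemma displacement_cost_change:
  assumes "disk_density \<mu>" "disk_density \<nu>" "m \<in> moebius_disk" "t \<in> moebius_disk" "z \<in> disk"
  shows "displacement_cost R \<mu> \<nu> m (t z) = (LINT x:geodesic_disk z R|vol_H. \<bar>\<mu> (t x) - \<nu> (m (t x))\<bar>)"
proof -
  have tz: "t z \<in> disk" using assms moebius_disk_mem by blast
  have "displacement_cost R \<mu> \<nu> m (t z)
      = (LINT x|vol_H. indicator (geodesic_disk (t z) R) (t x) * \<bar>\<mu> (t x) - \<nu> (m (t x))\<bar>)"
    unfolding displacement_cost_def set_lebesgue_integral_def real_scaleR_def
    using set_integrable_difference[OF assms(1-3) tz]
    by (intro integral_vol_H_moebius_disk[OF assms(4), symmetric]) auto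
  also have "\<dots> = (LINT x|vol_H. indicator (geodesic_disk z R) x * \<bar>\<mu> (t x) - \<nu> (m (t x))\<bar>)"
    using moebius_disk_geodesic_disk[OF assms(4) _ assms(5)]
    by (intro Bochner_Integration.integral_cong) (auto simp: indicator_def)
  finally show ?thesis by (simp add: set_lebesgue_integral_def)
qed

lemma displacement_cost_inverse:
  assumes "disk_density \<mu>" "disk_density \<nu>" "m \<in> moebius_disk" "n \<in> moebius_disk" "z \<in> disk"
    and "\<And>x. x \<in> disk \<Longrightarrow> n (m x) = x"
  shows "displacement_cost R \<nu> \<mu> n (m z) = displacement_cost R \<mu> \<nu> m z"
proof -
  have "displacement_cost R \<nu> \<mu> n (m z) = (LINT x:geodesic_disk z R|vol_H. \<bar>\<nu> (m x) - \<mu> (n (m x))\<bar>)"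
    by (rule displacement_cost_change[OF assms(2,1,4,3,5)])
  also have "\<dots> = displacement_cost R \<mu> \<nu> m z"
    unfolding displacement_cost_def set_lebesgue_integral_def
    using assms(6) by (intro Bochner_Integration.integral_cong) (auto simp: abs_minus_commute)
  finally show ?thesis .
qed

text \<open>Pointwise, \<open>\<mu>\<close> is compared with \<open>\<rho> \<circ> k\<close> through
  \<open>\<nu> \<circ> m\<close>. The second term becomes the cost of \<open>n\<close> after the
  substitution by \<open>m\<close>, which recenters the disk from \<open>m z\<close> to
  \<open>z\<close>.\<close>

lemma displacement_cost_triangle:
  assumes "disk_density \<mu>" "disk_density \<nu>" "disk_density \<rho>" "m \<in> moebius_disk" "n \<in> moebius_disk" "z \<in> disk"
    and k: "k \<in> moebius_disk" "\<And>x. x \<in> disk \<Longrightarrow> k x = n (m x)"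
  shows "displacement_cost R \<mu> \<rho> k z \<le> displacement_cost R \<mu> \<nu> m z + displacement_cost R \<nu> \<rho> n (m z)"
proof -
  let ?G = "geodesic_disk z R"
  have i1: "integrable vol_H (\<lambda>x. indicator ?G x * \<bar>\<mu> x - \<nu> (m x)\<bar>)"
    and i3: "integrable vol_H (\<lambda>x. indicator ?G x * \<bar>\<mu> x - \<rho> (k x)\<bar>)"
    using assms set_integrable_difference by blast+
  have i2: "integrable vol_H (\<lambda>x. indicator ?G x * \<bar>\<nu> (m x) - \<rho> (n (m x))\<bar>)"
    using integrable_mult_indicator[OF geodesic_disk_measurable[OF assms(6)]
        integrable_vol_H_moebius_disk[OF assms(4) integrable_difference[OF assms(2,3,5)]]]
    by simp
  have "displacement_cost R \<mu> \<rho> k z \<le> (LINT x|vol_H. indicator ?G x * \<bar>\<mu> x - \<nu> (m x)\<bar> + indicator ?G x * \<bar>\<nu> (m x) - \<rho> (n (m x))\<bar>)"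
    unfolding displacement_cost_def set_lebesgue_integral_def real_scaleR_def
    using i1 i2 i3 k(2) by (intro integral_mono) (auto simp: indicator_def)
  also have "\<dots> = displacement_cost R \<mu> \<nu> m z + displacement_cost R \<nu> \<rho> n (m z)"
    unfolding displacement_cost_change[OF assms(2,3,5,4,6)]
    unfolding displacement_cost_def set_lebesgue_integral_def real_scaleR_def
    by (rule Bochner_Integration.integral_add[OF i1 i2])
  finally show ?thesis .
qed

lemma local_cost_le:
  assumes "m \<in> moebius_disk" "m z = w"
  shows "local_cost R \<mu> \<nu> z w \<le> displacement_cost R \<mu> \<nu> m z"
  unfolding local_cost_alt using assms displacement_cost_nonneg
  by (intro cINF_lower bdd_belowI2[of _ 0]) auto

text \<open>Near-minimizers replace minimizers throughout, so that attainment of the infimum is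
  never at issue. Transitivity makes the index set nonempty, which the characterization of
  \<open>INF\<close> on the reals requires.\<close>

lemma local_cost_lessE:
  assumes "z \<in> disk" "w \<in> disk" "local_cost R \<mu> \<nu> z w < c"
  obtains m where "m \<in> moebius_disk" "m z = w" "displacement_cost R \<mu> \<nu> m z < c"
proof -
  have ne: "{m \<in> moebius_disk. m z = w} \<noteq> {}"
    using moebius_disk_transitive[OF assms(1,2)] by blast
  have "\<exists>m\<in>{m \<in> moebius_disk. m z = w}. displacement_cost R \<mu> \<nu> m z < c"
    using assms(3) ne displacement_cost_nonneg unfolding local_cost_alt
    by (subst (asm) cINF_less_iff) (auto intro!: bdd_belowI2[of _ 0])
  then show ?thesis using that by blast
qed

lemma local_cost_nonneg:
  assumes "z \<in> disk" "w \<in> disk"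
  shows "0 \<le> local_cost R \<mu> \<nu> z w"
proof (rule ccontr)
  assume "\<not> ?thesis"
  then obtain m where "displacement_cost R \<mu> \<nu> m z < 0"
    using local_cost_lessE[OF assms, of R \<mu> \<nu> 0] by auto
  then show False using displacement_cost_nonneg[of R \<mu> \<nu> m z] by simp
qed

lemma local_cost_le_2:
  assumes "disk_density \<mu>" "disk_density \<nu>" "z \<in> disk" "w \<in> disk"
  shows "local_cost R \<mu> \<nu> z w \<le> 2"
proof -
  obtain m where m: "m \<in> moebius_disk" "m z = w"
    using moebius_disk_transitive[OF assms(3,4)] by blast
  show ?thesis
    using local_cost_le[OF m, of R \<mu> \<nu>] displacement_cost_le_2[OF assms(1,2) m(1) assms(3), of R] by linarith
qed

lemma local_cost_sym_le:
  assumes "disk_density \<mu>" "disk_density \<nu>" "z \<in> disk" "w \<in> disk"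
  shows "local_cost R \<nu> \<mu> w z \<le> local_cost R \<mu> \<nu> z w"
proof (rule ccontr)
  assume "\<not> ?thesis"
  then obtain m where m: "m \<in> moebius_disk" "m z = w" "displacement_cost R \<mu> \<nu> m z < local_cost R \<nu> \<mu> w z"
    using local_cost_lessE[OF assms(3,4), of R \<mu> \<nu> "local_cost R \<nu> \<mu> w z"] by auto
  obtain n where n: "n \<in> moebius_disk" "\<And>z. z \<in> disk \<Longrightarrow> n (m z) = z" "\<And>z. z \<in> disk \<Longrightarrow> m (n z) = z"
    using moebius_disk_inverse[OF m(1)] by blast
  have "local_cost R \<nu> \<mu> w z \<le> displacement_cost R \<nu> \<mu> n w"
    using n(2)[OF assms(3)] m(2) by (intro local_cost_le n(1)) simp
  also have "\<dots> = displacement_cost R \<mu> \<nu> m z"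
    using displacement_cost_inverse[OF assms(1,2) m(1) n(1) assms(3) n(2)] m(2) by simp
  finally show False using m(3) by simp
qed

lemma local_cost_sym:
  assumes "disk_density \<mu>" "disk_density \<nu>" "z \<in> disk" "w \<in> disk"
  shows "local_cost R \<nu> \<mu> w z = local_cost R \<mu> \<nu> z w"
  by (rule antisym[OF local_cost_sym_le[OF assms] local_cost_sym_le[OF assms(2,1,4,3)]])

lemma local_cost_triangle:
  assumes "disk_density \<mu>" "disk_density \<nu>" "disk_density \<rho>" "x \<in> disk" "y \<in> disk" "z \<in> disk"
  shows "local_cost R \<mu> \<rho> x z \<le> local_cost R \<mu> \<nu> x y + local_cost R \<nu> \<rho> y z"
proof (rule field_le_epsilon)
  fix e :: real assume "e > 0"
  then obtain m where m: "m \<in> moebius_disk" "m x = y" "displacement_cost R \<mu> \<nu> m x < local_cost R \<mu> \<nu> x y + e/2"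
    using local_cost_lessE[OF assms(4,5), of R \<mu> \<nu> "local_cost R \<mu> \<nu> x y + e/2"] by auto
  obtain n where n: "n \<in> moebius_disk" "n y = z" "displacement_cost R \<nu> \<rho> n y < local_cost R \<nu> \<rho> y z + e/2"
    using local_cost_lessE[OF assms(5,6), of R \<nu> \<rho> "local_cost R \<nu> \<rho> y z + e/2"] \<open>e > 0\<close> by auto
  obtain k where k: "k \<in> moebius_disk" "\<And>x. x \<in> disk \<Longrightarrow> k x = n (m x)"
    using moebius_disk_comp[OF n(1) m(1)] by blast
  have "local_cost R \<mu> \<rho> x z \<le> displacement_cost R \<mu> \<rho> k x"
    using k m n assms by (intro local_cost_le) auto
  also have "\<dots> \<le> displacement_cost R \<mu> \<nu> m x + displacement_cost R \<nu> \<rho> n y"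
    using displacement_cost_triangle[OF assms(1-3) m(1) n(1) assms(4) k] m(2) by simp
  finally show "local_cost R \<mu> \<rho> x z \<le> local_cost R \<mu> \<nu> x y + local_cost R \<nu> \<rho> y z + e"
    using m(3) n(3) by linarith
qed

text \<open>\<open>m\<close> itself competes in the infimum, with integrand 0. For
  \<open>m = id\<close> this gives the zero diagonal of \<open>local_cost R \<nu> \<nu>\<close>, in
  general it makes transport along the graph of \<open>m\<close> free.\<close>

lemma local_cost_moebius:
  assumes "m \<in> moebius_disk" "\<And>x. x \<in> disk \<Longrightarrow> \<nu> (m x) = \<mu> x" "z \<in> disk"
  shows "local_cost R \<mu> \<nu> z (m z) = 0"
proof (rule antisym)
  have "displacement_cost R \<mu> \<nu> m z = 0"
    unfolding displacement_cost_def set_lebesgue_integral_def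
    using assms(2) by (intro integral_eq_zero_AE AE_I2) auto
  then show "local_cost R \<mu> \<nu> z (m z) \<le> 0"
    using local_cost_le[OF assms(1) refl, of R \<mu> \<nu> z] by simp
qed (use local_cost_nonneg moebius_disk_mem assms in blast)

text \<open>The Moebius transformations taking \<open>z\<close> to \<open>w\<close> are parametrized by an angle \<open>\<theta>\<close>. For fixed
  \<open>\<theta>\<close> the cost depends continuously on \<open>(z, w)\<close>, so the infimum over \<open>\<theta>\<close> is upper semicontinuous.\<close>

definition rotation_cost :: "real \<Rightarrow> (complex \<Rightarrow> real) \<Rightarrow> (complex \<Rightarrow> real) \<Rightarrow> real \<Rightarrow> complex \<times> complex \<Rightarrow> real" where
  "rotation_cost R \<mu> \<nu> \<theta> p = (LINT u:cball 0 (tanh R)|vol_H.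
     \<bar>\<mu> (Moebius_function 0 (- fst p) u) - \<nu> (Moebius_function 0 (- snd p) (cis \<theta> * u))\<bar>)"

lemma Moebius_function_0_in_moebius_disk:
  assumes "a \<in> disk" shows "Moebius_function 0 a \<in> moebius_disk"
  using assms unfolding moebius_disk_def by (auto intro!: exI[of _ "0::real"])

text \<open>The substitution that moves 0 to \<open>z\<close> replaces the moving domain of
  integration by the fixed ball \<open>cball 0 (tanh R)\<close>; the dependence on
  \<open>(z, w)\<close> then sits in the integrand alone.\<close>

lemma displacement_cost_eq_rotation_cost:
  assumes "disk_density \<mu>" "disk_density \<nu>" "m \<in> moebius_disk" "z \<in> disk" "w \<in> disk"
    and "\<And>u. u \<in> disk \<Longrightarrow> m (Moebius_function 0 (- z) u) = Moebius_function 0 (- w) (cis \<theta> * u)"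
  shows "displacement_cost R \<mu> \<nu> m z = rotation_cost R \<mu> \<nu> \<theta> (z, w)"
proof -
  have t: "Moebius_function 0 (- z) \<in> moebius_disk" using assms(4) by (intro Moebius_function_0_in_moebius_disk) simp
  have tz: "Moebius_function 0 (- z) 0 = z" by (simp add: Moebius_function_of_zero)
  have "displacement_cost R \<mu> \<nu> m z = (LINT x:geodesic_disk 0 R|vol_H.
      \<bar>\<mu> (Moebius_function 0 (- z) x) - \<nu> (m (Moebius_function 0 (- z) x))\<bar>)"
    using displacement_cost_change[OF assms(1-3) t, of 0 R] by (simp add: tz)
  also have "\<dots> = rotation_cost R \<mu> \<nu> \<theta> (z, w)"
    unfolding rotation_cost_def geodesic_disk_0 set_lebesgue_integral_def
    using assms(6) by (intro Bochner_Integration.integral_cong) auto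
  finally show ?thesis .
qed

text \<open>Preceding \<open>m\<close> by a transformation taking 0 to \<open>z\<close> and
  following it by one taking \<open>w\<close> to 0 gives an automorphism fixing 0, hence a
  rotation.\<close>

lemma moebius_disk_rotation_form:
  assumes "m \<in> moebius_disk" "z \<in> disk" "m z = w"
  obtains \<theta> where "\<And>u. u \<in> disk \<Longrightarrow> m (Moebius_function 0 (- z) u) = Moebius_function 0 (- w) (cis \<theta> * u)"
proof -
  let ?S = "Moebius_function 0 (- z)" and ?T = "Moebius_function 0 w"
  have w: "w \<in> disk" using assms moebius_disk_mem by blast
  have S: "?S \<in> moebius_disk" and T: "?T \<in> moebius_disk"
    using assms(2) w by (auto intro!: Moebius_function_0_in_moebius_disk)
  obtain k where k: "k \<in> moebius_disk" "\<And>x. x \<in> disk \<Longrightarrow> k x = m (?S x)"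
    using moebius_disk_comp[OF assms(1) S] by blast
  obtain n where n: "n \<in> moebius_disk" "\<And>x. x \<in> disk \<Longrightarrow> n x = ?T (k x)"
    using moebius_disk_comp[OF T k(1)] by blast
  have "n 0 = 0"
    using n(2)[of 0] k(2)[of 0] assms(3) by (simp add: Moebius_function_of_zero Moebius_function_eq_zero)
  then obtain \<theta> where \<theta>: "n = (\<lambda>z. cis \<theta> * z)" using moebius_disk_fixing_0[OF n(1)] by blast
  have "m (?S u) = Moebius_function 0 (- w) (cis \<theta> * u)" if u: "u \<in> disk" for u
  proof -
    have "k u \<in> disk" using k(1) u moebius_disk_mem by blast
    then have "Moebius_function 0 (- w) (?T (k u)) = k u"
      using w by (intro Moebius_function_compose) auto
    then show ?thesis using n(2)[OF u] k(2)[OF u] by (simp add: \<theta>)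
  qed
  then show ?thesis using that by blast
qed

lemma moebius_disk_from_rotation:
  assumes "z \<in> disk" "w \<in> disk"
  obtains m where "m \<in> moebius_disk" "m z = w"
     "\<And>u. u \<in> disk \<Longrightarrow> m (Moebius_function 0 (- z) u) = Moebius_function 0 (- w) (cis \<theta> * u)"
proof -
  have S: "Moebius_function 0 z \<in> moebius_disk" and T: "Moebius_function 0 (-w) \<in> moebius_disk"
    using assms by (auto intro!: Moebius_function_0_in_moebius_disk)
  obtain r where r: "r \<in> moebius_disk" "\<And>x. x \<in> disk \<Longrightarrow> r x = cis \<theta> * x"
    using disk_automorphism_is_moebius[OF disk_automorphism_rotation[of "cis \<theta>"]] by auto
  obtain k where k: "k \<in> moebius_disk" "\<And>x. x \<in> disk \<Longrightarrow> k x = r (Moebius_function 0 z x)"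
    using moebius_disk_comp[OF r(1) S] by blast
  obtain m where m: "m \<in> moebius_disk" "\<And>x. x \<in> disk \<Longrightarrow> m x = Moebius_function 0 (-w) (k x)"
    using moebius_disk_comp[OF T k(1)] by blast
  have mS: "m (Moebius_function 0 (- z) u) = Moebius_function 0 (- w) (cis \<theta> * u)" if u: "u \<in> disk" for u
  proof -
    have "Moebius_function 0 (- z) u \<in> disk"
      using assms(1) by (intro moebius_disk_mem[OF Moebius_function_0_in_moebius_disk u]) auto
    moreover have "Moebius_function 0 z (Moebius_function 0 (- z) u) = u"
      using assms(1) u by (intro Moebius_function_compose) auto
    ultimately show ?thesis using m(2) k(2) r(2)[OF u] by simp
  qed
  have "m z = w" using mS[of 0] by (simp add: Moebius_function_of_zero)
  then show ?thesis using that m(1) mS by blast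
qed

lemma continuous_on_rotation_cost:
  assumes "disk_density \<mu>" "disk_density \<nu>"
  shows "continuous_on (disk \<times> disk) (rotation_cost R \<mu> \<nu> \<theta>)"
proof -
  let ?K = "cball (0::complex) (tanh R)"
  \<comment> \<open>\<open>tanh R < 1\<close> keeps the ball away from the unit circle, so its area
    is finite and continuity of the densities inside the disk suffices.\<close>
  have K: "compact ?K" "?K \<subseteq> disk" using tanh_real_lt_1[of R] by auto
  have mem: "Moebius_function 0 (- a) u \<in> disk" if "a \<in> disk" "u \<in> disk" for a u
    using that by (auto intro!: Moebius_function_norm_lt_1)
  have nz: "1 - cnj (- a) * u \<noteq> 0" if "a \<in> disk" "u \<in> disk" for a u
    using that by (intro one_minus_cnj_mult_nonzero) auto
  have M: "continuous_on X (\<lambda>q. Moebius_function 0 (- f q) (g q))"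
    if "continuous_on X f" "continuous_on X g" "f \<in> X \<rightarrow> disk" "g \<in> X \<rightarrow> disk" for f g and X :: "((complex \<times> complex) \<times> complex) set"
    unfolding Moebius_function_simple using that nz
    by (intro continuous_on_divide continuous_on_diff continuous_on_minus continuous_on_mult continuous_on_cnj continuous_on_const) blast+
  let ?X = "(disk \<times> disk) \<times> ?K"
  have p: "(\<lambda>q. fst (fst q)) \<in> ?X \<rightarrow> disk" "(\<lambda>q. snd (fst q)) \<in> ?X \<rightarrow> disk" "snd \<in> ?X \<rightarrow> disk"
    "(\<lambda>q. cis \<theta> * snd q) \<in> ?X \<rightarrow> disk"
    using tanh_real_lt_1[of R] by (auto simp: norm_mult)
  have c1: "continuous_on ?X (\<lambda>q. Moebius_function 0 (- fst (fst q)) (snd q))"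
    by (rule M[OF _ _ p(1,3)]) (intro continuous_intros)+
  have c2: "continuous_on ?X (\<lambda>q. Moebius_function 0 (- snd (fst q)) (cis \<theta> * snd q))"
    by (rule M[OF _ _ p(2,4)]) (intro continuous_intros)+
  have i1: "(\<lambda>q. Moebius_function 0 (- fst (fst q)) (snd q)) ` ?X \<subseteq> disk"
    by (rule image_subsetI) (rule mem[OF Pi_mem[OF p(1)] Pi_mem[OF p(3)]])
  have i2: "(\<lambda>q. Moebius_function 0 (- snd (fst q)) (cis \<theta> * snd q)) ` ?X \<subseteq> disk"
    by (rule image_subsetI) (rule mem[OF Pi_mem[OF p(2)] Pi_mem[OF p(4)]])
  have "continuous_on ?X (\<lambda>q. \<mu> (Moebius_function 0 (- fst (fst q)) (snd q)))"
    by (rule continuous_on_compose2[OF disk_densityD(1)[OF assms(1)] c1 i1])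
  moreover have "continuous_on ?X (\<lambda>q. \<nu> (Moebius_function 0 (- snd (fst q)) (cis \<theta> * snd q)))"
    by (rule continuous_on_compose2[OF disk_densityD(1)[OF assms(2)] c2 i2])
  ultimately have "continuous_on ?X (\<lambda>q. \<bar>\<mu> (Moebius_function 0 (- fst (fst q)) (snd q))
       - \<nu> (Moebius_function 0 (- snd (fst q)) (cis \<theta> * snd q))\<bar>)"
    by (intro continuous_on_rabs continuous_on_diff)
  then have "continuous_on ?X (\<lambda>(p, u). \<bar>\<mu> (Moebius_function 0 (- fst p) u)
       - \<nu> (Moebius_function 0 (- snd p) (cis \<theta> * u))\<bar>)"
    by (simp only: case_prod_unfold)
  from continuous_on_integral_compact[OF K this] show ?thesis
    unfolding rotation_cost_def[abs_def] .
qed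

text \<open>The union over \<open>\<theta>\<close> is uncountable: openness survives it, whereas
  measurability alone might not. Measurability of the local cost is then read off from this
  openness.\<close>

lemma open_local_cost_less:
  assumes "disk_density \<mu>" "disk_density \<nu>"
  shows "open {p \<in> disk \<times> disk. local_cost R \<mu> \<nu> (fst p) (snd p) < c}"
proof -
  have o: "open (disk \<times> disk)" by (intro open_Times open_ball)
  have "{p \<in> disk \<times> disk. local_cost R \<mu> \<nu> (fst p) (snd p) < c} =
      (\<Union>\<theta>. {p \<in> disk \<times> disk. rotation_cost R \<mu> \<nu> \<theta> p \<in> {..<c}})" (is "?L = ?R")
  proof (intro set_eqI iffI)
    fix p assume "p \<in> ?L"
    then obtain z w where p: "p = (z, w)" "z \<in> disk" "w \<in> disk" "local_cost R \<mu> \<nu> z w < c"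
      by (cases p) auto
    obtain m where m: "m \<in> moebius_disk" "m z = w" "displacement_cost R \<mu> \<nu> m z < c"
      using local_cost_lessE[OF p(2-4)] by blast
    obtain \<theta> where "\<And>u. u \<in> disk \<Longrightarrow> m (Moebius_function 0 (- z) u) = Moebius_function 0 (- w) (cis \<theta> * u)"
      using moebius_disk_rotation_form[OF m(1) p(2) m(2)] by blast
    then have "rotation_cost R \<mu> \<nu> \<theta> p < c"
      using displacement_cost_eq_rotation_cost[OF assms m(1) p(2,3)] m(3) p(1) by simp
    then show "p \<in> ?R" using p by auto
  next
    fix p assume "p \<in> ?R"
    then obtain z w \<theta> where p: "p = (z, w)" "z \<in> disk" "w \<in> disk" "rotation_cost R \<mu> \<nu> \<theta> (z, w) < c"
      by (cases p) auto
    obtain m where m: "m \<in> moebius_disk" "m z = w"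
      "\<And>u. u \<in> disk \<Longrightarrow> m (Moebius_function 0 (- z) u) = Moebius_function 0 (- w) (cis \<theta> * u)"
      using moebius_disk_from_rotation[OF p(2,3)] by blast
    have "local_cost R \<mu> \<nu> z w < c"
      using local_cost_le[OF m(1,2), of R \<mu> \<nu>] displacement_cost_eq_rotation_cost[OF assms m(1) p(2,3) m(3), of R] p(4)
      by simp
    then show "p \<in> ?L" using p by auto
  qed
  moreover have "open {p \<in> disk \<times> disk. rotation_cost R \<mu> \<nu> \<theta> p \<in> {..<c}}" for \<theta>
    using continuous_open_preimage[OF continuous_on_rotation_cost[OF assms] o open_lessThan, of R \<theta> c]
    by (simp add: vimage_def Int_def)
  ultimately show ?thesis by auto
qed

lemma space_vol_H_pair: "space (vol_H \<Otimes>\<^sub>M vol_H) = disk \<times> disk"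
  by (simp add: space_pair_measure)

text \<open>The product of the Borel sigma-algebras contains the open sets because
  \<open>complex\<close> is second countable, a fact that enters through
  \<open>borel_measurable_Pair\<close>.\<close>

lemma open_in_sets_vol_H_pair:
  assumes "open U" "U \<subseteq> disk \<times> disk"
  shows "U \<in> sets (vol_H \<Otimes>\<^sub>M vol_H)"
proof -
  have id1: "(\<lambda>x. x) \<in> measurable vol_H borel"
    by (rule borel_measurable_vol_H_borel) simp
  have "(\<lambda>p. (fst p, snd p)) \<in> borel_measurable (vol_H \<Otimes>\<^sub>M vol_H)"
    by (rule borel_measurable_Pair) (rule measurable_compose[OF measurable_fst id1] measurable_compose[OF measurable_snd id1])+
  then have "(\<lambda>p. p) \<in> borel_measurable (vol_H \<Otimes>\<^sub>M vol_H)" by simp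
  from measurable_sets[OF this, of U] assms show ?thesis
    by (simp add: space_vol_H_pair Int_absorb2 vimage_def)
qed

lemma borel_measurable_local_cost:
  assumes "disk_density \<mu>" "disk_density \<nu>"
  shows "(\<lambda>p. local_cost R \<mu> \<nu> (fst p) (snd p)) \<in> borel_measurable (vol_H \<Otimes>\<^sub>M vol_H)"
  unfolding borel_measurable_iff_less space_vol_H_pair
  using open_in_sets_vol_H_pair[OF open_local_cost_less[OF assms]] by (simp only: Collect_restrict) blast

section \<open>Transport plans\<close>

text \<open>Within each pair of matching cells one takes the normalized product measure; here
  \<open>inverse 0 = \<infinity>\<close> is harmless, because cells of mass 0 are negligible.\<close>

lemma coupling_of_matching_partitions:
  fixes f :: "'a \<Rightarrow> nat" and g :: "'b \<Rightarrow> nat"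
  assumes A: "prob_space A" and B: "prob_space B"
    and f [measurable]: "f \<in> measurable A (count_space UNIV)"
    and g [measurable]: "g \<in> measurable B (count_space UNIV)"
    and fg: "distr A (count_space UNIV) f = distr B (count_space UNIV) g"
  obtains \<Gamma> where "sets \<Gamma> = sets (A \<Otimes>\<^sub>M B)" "distr \<Gamma> A fst = A" "distr \<Gamma> B snd = B"
    "AE w in \<Gamma>. f (fst w) = g (snd w)"
proof -
  interpret A: prob_space A by (rule A)
  interpret B: prob_space B by (rule B)
  interpret AB: pair_sigma_finite A B ..
  define Q where "Q n = emeasure A (f -` {n} \<inter> space A)" for n
  have QB: "Q n = emeasure B (g -` {n} \<inter> space B)" for n
  proof -
    have "emeasure (distr A (count_space UNIV) f) {n} = emeasure (distr B (count_space UNIV) g) {n}"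
      by (simp only: fg)
    then show ?thesis by (simp add: emeasure_distr Q_def)
  qed
  have Qfin: "Q n < \<infinity>" for n
    unfolding Q_def by (simp add: less_top[symmetric] A.emeasure_finite)
  \<comment> \<open>On the block formed by the two cells of index \<open>n\<close> the density is
    the constant \<open>inverse (Q n)\<close>; the block has product measure
    \<open>Q n * Q n\<close> and so receives mass \<open>Q n\<close>. All other blocks receive
    none.\<close>
  define h where "h w = (if f (fst w) = g (snd w) then inverse (Q (f (fst w))) else 0)" for w
  have h[measurable]: "h \<in> borel_measurable (A \<Otimes>\<^sub>M B)"
  proof -
    have "(\<lambda>w. if n = g (snd w) then inverse (Q n) else 0) \<in> borel_measurable (A \<Otimes>\<^sub>M B)" for n
      by (rule measurable_compose[OF measurable_compose[OF measurable_snd g], of "\<lambda>k. if n = k then inverse (Q n) else 0"]) simp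
    from measurable_compose_countable[OF this measurable_compose[OF measurable_fst f]]
    show ?thesis unfolding h_def .
  qed
  define \<Gamma> where "\<Gamma> = density (A \<Otimes>\<^sub>M B) h"
  have QQ: "inverse (Q n) * Q n = (if Q n = 0 then 0 else 1)" for n
    using Qfin[of n] ennreal_divide_self[of "Q n"] by (simp add: divide_ennreal_def mult.commute)
  have inner1: "(\<integral>\<^sup>+y. h (x, y) \<partial>B) = (if Q (f x) = 0 then 0 else 1)" for x
  proof -
    have "(\<integral>\<^sup>+y. h (x, y) \<partial>B) = (\<integral>\<^sup>+y. inverse (Q (f x)) * indicator (g -` {f x} \<inter> space B) y \<partial>B)"
      by (intro nn_integral_cong) (auto simp: h_def indicator_def)
    also have "\<dots> = inverse (Q (f x)) * Q (f x)"
      by (simp add: nn_integral_cmult_indicator QB)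
    finally show ?thesis by (simp add: QQ)
  qed
  have inner2: "(\<integral>\<^sup>+x. h (x, y) \<partial>A) = (if Q (g y) = 0 then 0 else 1)" for y
  proof -
    have "(\<integral>\<^sup>+x. h (x, y) \<partial>A) = (\<integral>\<^sup>+x. inverse (Q (g y)) * indicator (f -` {g y} \<inter> space A) x \<partial>A)"
      by (intro nn_integral_cong) (auto simp: h_def indicator_def)
    also have "\<dots> = inverse (Q (g y)) * Q (g y)"
      by (simp add: nn_integral_cmult_indicator Q_def)
    finally show ?thesis by (simp add: QQ)
  qed
  \<comment> \<open>There are countably many cells, so those of mass 0 together form a null
    set.\<close>
  have AE1: "AE x in A. Q (f x) \<noteq> 0"
  proof -
    have "AE x in A. \<forall>n. Q n = 0 \<longrightarrow> f x \<noteq> n"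
      unfolding AE_all_countable
    proof
      fix n
      show "AE x in A. Q n = 0 \<longrightarrow> f x \<noteq> n"
      proof (cases "Q n = 0")
        case True
        then have "f -` {n} \<inter> space A \<in> null_sets A" by (auto simp: Q_def null_sets_def)
        from AE_not_in[OF this] show ?thesis by (rule AE_mp) (auto intro!: AE_I2)
      qed simp
    qed
    then show ?thesis by (rule AE_mp) (auto intro!: AE_I2)
  qed
  have AE2: "AE y in B. Q (g y) \<noteq> 0"
  proof -
    have "AE y in B. \<forall>n. Q n = 0 \<longrightarrow> g y \<noteq> n"
      unfolding AE_all_countable
    proof
      fix n
      show "AE y in B. Q n = 0 \<longrightarrow> g y \<noteq> n"
      proof (cases "Q n = 0")
        case True
        then have "g -` {n} \<inter> space B \<in> null_sets B" by (auto simp: QB null_sets_def)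
        from AE_not_in[OF this] show ?thesis by (rule AE_mp) (auto intro!: AE_I2)
      qed simp
    qed
    then show ?thesis by (rule AE_mp) (auto intro!: AE_I2)
  qed
  have sets: "sets \<Gamma> = sets (A \<Otimes>\<^sub>M B)" by (simp add: \<Gamma>_def)
  have m1: "fst \<in> measurable \<Gamma> A" and m2: "snd \<in> measurable \<Gamma> B"
    by (simp_all add: \<Gamma>_def)
  have sp: "space \<Gamma> = space A \<times> space B" by (simp add: \<Gamma>_def space_pair_measure)
  have d1: "distr \<Gamma> A fst = A"
  proof (rule measure_eqI)
    fix X assume "X \<in> sets (distr \<Gamma> A fst)"
    then have X[measurable]: "X \<in> sets A" by simp
    have "emeasure (distr \<Gamma> A fst) X = emeasure \<Gamma> (fst -` X \<inter> space \<Gamma>)"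
      using m1 by (simp add: emeasure_distr)
    also have "\<dots> = (\<integral>\<^sup>+w. h w * indicator (fst -` X \<inter> space \<Gamma>) w \<partial>(A \<Otimes>\<^sub>M B))"
      using measurable_sets[OF m1 X] unfolding \<Gamma>_def by (intro emeasure_density) auto
    also have "\<dots> = (\<integral>\<^sup>+w. h w * indicator X (fst w) \<partial>(A \<Otimes>\<^sub>M B))"
      by (intro nn_integral_cong) (auto simp: indicator_def sp space_pair_measure)
    \<comment> \<open>Integrating \<open>h\<close> over the second variable leaves the density
      computed in \<open>inner1\<close>, which equals 1 almost everywhere by
      \<open>AE1\<close>.\<close>
    also have "\<dots> = (\<integral>\<^sup>+x. \<integral>\<^sup>+y. h (x, y) * indicator X x \<partial>B \<partial>A)"
      by (subst B.nn_integral_fst[symmetric]) auto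
    also have "\<dots> = (\<integral>\<^sup>+x. (if Q (f x) = 0 then 0 else 1) * indicator X x \<partial>A)"
      by (intro nn_integral_cong) (simp add: nn_integral_multc inner1)
    also have "\<dots> = (\<integral>\<^sup>+x. indicator X x \<partial>A)"
      using AE1 by (intro nn_integral_cong_AE) auto
    finally show "emeasure (distr \<Gamma> A fst) X = emeasure A X" by simp
  qed simp
  have d2: "distr \<Gamma> B snd = B"
  proof (rule measure_eqI)
    fix X assume "X \<in> sets (distr \<Gamma> B snd)"
    then have X[measurable]: "X \<in> sets B" by simp
    have "emeasure (distr \<Gamma> B snd) X = emeasure \<Gamma> (snd -` X \<inter> space \<Gamma>)"
      using m2 by (simp add: emeasure_distr)
    also have "\<dots> = (\<integral>\<^sup>+w. h w * indicator (snd -` X \<inter> space \<Gamma>) w \<partial>(A \<Otimes>\<^sub>M B))"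
      using measurable_sets[OF m2 X] unfolding \<Gamma>_def by (intro emeasure_density) auto
    also have "\<dots> = (\<integral>\<^sup>+w. h w * indicator X (snd w) \<partial>(A \<Otimes>\<^sub>M B))"
      by (intro nn_integral_cong) (auto simp: indicator_def sp space_pair_measure)
    also have "\<dots> = (\<integral>\<^sup>+y. \<integral>\<^sup>+x. h (x, y) * indicator X y \<partial>A \<partial>B)"
      by (subst AB.nn_integral_snd[symmetric]) auto
    also have "\<dots> = (\<integral>\<^sup>+y. (if Q (g y) = 0 then 0 else 1) * indicator X y \<partial>B)"
      by (intro nn_integral_cong) (simp add: nn_integral_multc inner2)
    also have "\<dots> = (\<integral>\<^sup>+y. indicator X y \<partial>B)"
      using AE2 by (intro nn_integral_cong_AE) auto
    finally show "emeasure (distr \<Gamma> B snd) X = emeasure B X" by simp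
  qed simp
  have "AE w in \<Gamma>. f (fst w) = g (snd w)"
    unfolding \<Gamma>_def by (subst AE_density) (auto simp: h_def intro!: AE_I2)
  with that[OF sets d1 d2] show ?thesis by blast
qed

section \<open>Densities as probability measures, couplings and their cost\<close>

lemma prob_space_density_measure:
  assumes "disk_density \<mu>"
  shows "prob_space (density_measure \<mu>)"
proof (rule prob_spaceI)
  have m: "(\<lambda>z. ennreal (\<mu> z)) \<in> borel_measurable vol_H"
    using borel_measurable_integrable[OF disk_densityD(3)[OF assms]] by measurable
  have "emeasure (density_measure \<mu>) (space (density_measure \<mu>)) = (\<integral>\<^sup>+z. ennreal (\<mu> z) * indicator (space vol_H) z \<partial>vol_H)"
    unfolding density_measure_def space_density by (rule emeasure_density[OF m sets.top])
  also have "\<dots> = (\<integral>\<^sup>+z. ennreal (\<mu> z) \<partial>vol_H)"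
    by (intro nn_integral_cong) auto
  also have "\<dots> = ennreal (LINT z|vol_H. \<mu> z)"
    using disk_densityD(2)[OF assms] by (intro nn_integral_eq_integral disk_densityD(3)[OF assms] AE_I2) (auto intro: less_imp_le)
  finally show "emeasure (density_measure \<mu>) (space (density_measure \<mu>)) = 1"
    using disk_densityD(4)[OF assms] by simp
qed

lemma sets_density_measure [simp, measurable_cong]: "sets (density_measure \<mu>) = sets vol_H"
  by (simp add: density_measure_def)

lemma space_density_measure [simp]: "space (density_measure \<mu>) = disk"
  by (simp add: density_measure_def)

lemma couplingsD:
  assumes "\<pi> \<in> couplings \<mu> \<nu>"
  shows "prob_space \<pi>" "sets \<pi> = sets (vol_H \<Otimes>\<^sub>M vol_H)" "space \<pi> = disk \<times> disk"
    "distr \<pi> vol_H fst = density_measure \<mu>" "distr \<pi> vol_H snd = density_measure \<nu>"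
    "fst \<in> measurable \<pi> vol_H" "snd \<in> measurable \<pi> vol_H"
proof -
  show *: "prob_space \<pi>" "sets \<pi> = sets (vol_H \<Otimes>\<^sub>M vol_H)"
    "distr \<pi> vol_H fst = density_measure \<mu>" "distr \<pi> vol_H snd = density_measure \<nu>"
    using assms by (auto simp: couplings_def)
  show "space \<pi> = disk \<times> disk"
    using sets_eq_imp_space_eq[OF *(2)] by (simp add: space_vol_H_pair)
  show "fst \<in> measurable \<pi> vol_H" "snd \<in> measurable \<pi> vol_H"
    by (simp_all add: measurable_cong_sets[OF *(2) refl])
qed

text \<open>Provides a plan, so that the infimum in \<open>transport_cost\<close> is taken over a
  nonempty set.\<close>

lemma product_in_couplings:
  assumes "disk_density \<mu>" "disk_density \<nu>"
  shows "density_measure \<mu> \<Otimes>\<^sub>M density_measure \<nu> \<in> couplings \<mu> \<nu>"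
proof -
  interpret A: prob_space "density_measure \<mu>" by (rule prob_space_density_measure[OF assms(1)])
  interpret B: prob_space "density_measure \<nu>" by (rule prob_space_density_measure[OF assms(2)])
  interpret AB: pair_prob_space "density_measure \<mu>" "density_measure \<nu>" ..
  have s: "sets (density_measure \<mu> \<Otimes>\<^sub>M density_measure \<nu>) = sets (vol_H \<Otimes>\<^sub>M vol_H)"
    by (intro sets_pair_measure_cong) auto
  have 1: "distr (density_measure \<mu> \<Otimes>\<^sub>M density_measure \<nu>) vol_H fst = density_measure \<mu>"
  proof -
    \<comment> \<open>\<open>vol_H\<close> and \<open>density_measure \<mu>\<close> have the same
      measurable sets, so either may serve as the target of \<open>distr\<close>.\<close>
    have "distr (density_measure \<mu> \<Otimes>\<^sub>M density_measure \<nu>) vol_H fst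
       = distr (density_measure \<mu> \<Otimes>\<^sub>M density_measure \<nu>) (density_measure \<mu>) fst"
      by (rule distr_cong) auto
    then show ?thesis by (simp add: B.distr_pair_fst)
  qed
  have 2: "distr (density_measure \<mu> \<Otimes>\<^sub>M density_measure \<nu>) vol_H snd = density_measure \<nu>"
  proof (rule measure_eqI)
    fix X assume "X \<in> sets (distr (density_measure \<mu> \<Otimes>\<^sub>M density_measure \<nu>) vol_H snd)"
    then have X: "X \<in> sets (density_measure \<nu>)" by simp
    have "emeasure (distr (density_measure \<mu> \<Otimes>\<^sub>M density_measure \<nu>) vol_H snd) X
      = emeasure (density_measure \<mu> \<Otimes>\<^sub>M density_measure \<nu>) (space (density_measure \<mu>) \<times> X)"
      using X sets.sets_into_space[OF X]
      by (subst emeasure_distr) (auto simp: space_pair_measure measurable_cong_sets[OF s refl] intro!: arg_cong2[where f=emeasure])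
    also have "\<dots> = emeasure (density_measure \<nu>) X"
      using A.emeasure_space_1 by (subst B.emeasure_pair_measure_Times[OF sets.top X]) simp
    finally show "emeasure (distr (density_measure \<mu> \<Otimes>\<^sub>M density_measure \<nu>) vol_H snd) X = emeasure (density_measure \<nu>) X" .
  qed simp
  show ?thesis unfolding couplings_def using s 1 2 AB.prob_space_axioms by blast
qed

definition coupling_cost :: "real \<Rightarrow> (complex \<Rightarrow> real) \<Rightarrow> (complex \<Rightarrow> real) \<Rightarrow> (complex \<times> complex) measure \<Rightarrow> real" where
  "coupling_cost R \<mu> \<nu> \<pi> = (LINT p|\<pi>. local_cost R \<mu> \<nu> (fst p) (snd p))"

lemma integrable_local_cost:
  assumes "disk_density \<mu>" "disk_density \<nu>" "\<pi> \<in> couplings \<mu>' \<nu>'"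
  shows "integrable \<pi> (\<lambda>p. local_cost R \<mu> \<nu> (fst p) (snd p))"
proof -
  interpret prob_space \<pi> using couplingsD(1)[OF assms(3)] .
  show ?thesis
  proof (rule integrable_const_bound[where B=2])
    show "(\<lambda>p. local_cost R \<mu> \<nu> (fst p) (snd p)) \<in> borel_measurable \<pi>"
      using borel_measurable_local_cost[OF assms(1,2)]
      by (simp only: measurable_cong_sets[OF couplingsD(2)[OF assms(3)] refl])
    show "AE p in \<pi>. norm (local_cost R \<mu> \<nu> (fst p) (snd p)) \<le> 2"
      using local_cost_nonneg local_cost_le_2[OF assms(1,2)]
      by (intro AE_I2) (auto simp: couplingsD(3)[OF assms(3)] abs_of_nonneg)
  qed
qed

lemma coupling_cost_nonneg:
  assumes "\<pi> \<in> couplings \<mu>' \<nu>'"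
  shows "0 \<le> coupling_cost R \<mu> \<nu> \<pi>"
  unfolding coupling_cost_def
  by (rule Bochner_Integration.integral_nonneg) (use local_cost_nonneg couplingsD(3)[OF assms] in auto)

lemma transport_cost_le:
  assumes "\<pi> \<in> couplings \<mu> \<nu>"
  shows "transport_cost R \<mu> \<nu> \<le> coupling_cost R \<mu> \<nu> \<pi>"
  unfolding transport_cost_def coupling_cost_def[symmetric]
  by (intro cINF_lower[OF _ assms] bdd_belowI2[of _ 0] coupling_cost_nonneg)

lemma transport_cost_lessE:
  assumes "disk_density \<mu>" "disk_density \<nu>" "transport_cost R \<mu> \<nu> < c"
  obtains \<pi> where "\<pi> \<in> couplings \<mu> \<nu>" "coupling_cost R \<mu> \<nu> \<pi> < c"
proof -
  have "bdd_below (coupling_cost R \<mu> \<nu> ` couplings \<mu> \<nu>)"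
    by (intro bdd_belowI2[of _ 0] coupling_cost_nonneg)
  moreover have "couplings \<mu> \<nu> \<noteq> {}" using product_in_couplings[OF assms(1,2)] by blast
  ultimately have "\<exists>\<pi>\<in>couplings \<mu> \<nu>. coupling_cost R \<mu> \<nu> \<pi> < c"
    using assms(3) unfolding transport_cost_def coupling_cost_def[symmetric] by (simp add: cINF_less_iff)
  then show ?thesis using that by blast
qed

lemma transport_cost_nonneg:
  assumes "disk_density \<mu>" "disk_density \<nu>"
  shows "0 \<le> transport_cost R \<mu> \<nu>"
proof (rule ccontr)
  assume "\<not> ?thesis"
  then obtain \<pi> where "\<pi> \<in> couplings \<mu> \<nu>" "coupling_cost R \<mu> \<nu> \<pi> < 0"
    using transport_cost_lessE[OF assms, of R 0] by auto
  then show False using coupling_cost_nonneg by (meson not_less)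
qed

text \<open>The swap \<open>sw\<close> reverses a plan, and \<open>local_cost_sym\<close> shows that
  the reversed plan has the same cost.\<close>

lemma transport_cost_sym_le:
  assumes "disk_density \<mu>" "disk_density \<nu>"
  shows "transport_cost R \<nu> \<mu> \<le> transport_cost R \<mu> \<nu>"
proof (rule ccontr)
  assume "\<not> ?thesis"
  then obtain \<pi> where \<pi>: "\<pi> \<in> couplings \<mu> \<nu>" "coupling_cost R \<mu> \<nu> \<pi> < transport_cost R \<nu> \<mu>"
    using transport_cost_lessE[OF assms, of R "transport_cost R \<nu> \<mu>"] by auto
  note c = couplingsD[OF \<pi>(1)]
  interpret prob_space \<pi> by (rule c(1))
  define sw where "sw p = (snd p, fst p)" for p :: "complex \<times> complex"
  have sw: "sw \<in> measurable \<pi> (vol_H \<Otimes>\<^sub>M vol_H)"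
    unfolding sw_def using c(6,7) by (intro measurable_Pair)
  define \<pi>' where "\<pi>' = distr \<pi> (vol_H \<Otimes>\<^sub>M vol_H) sw"
  have "\<pi>' \<in> couplings \<nu> \<mu>"
    unfolding couplings_def
  proof (intro CollectI conjI)
    show "prob_space \<pi>'" unfolding \<pi>'_def by (rule prob_space_distr[OF sw])
    show "distr \<pi>' vol_H fst = density_measure \<nu>" "distr \<pi>' vol_H snd = density_measure \<mu>"
      unfolding \<pi>'_def using c(4,5) by (simp_all add: distr_distr[OF _ sw] o_def sw_def)
  qed (simp add: \<pi>'_def)
  then have "transport_cost R \<nu> \<mu> \<le> coupling_cost R \<nu> \<mu> \<pi>'"
    by (rule transport_cost_le)
  also have "coupling_cost R \<nu> \<mu> \<pi>' = (LINT p|\<pi>. local_cost R \<nu> \<mu> (fst (sw p)) (snd (sw p)))"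
    unfolding coupling_cost_def \<pi>'_def by (rule integral_distr[OF sw borel_measurable_local_cost[OF assms(2,1)]])
  also have "\<dots> = coupling_cost R \<mu> \<nu> \<pi>"
    unfolding coupling_cost_def
    by (rule Bochner_Integration.integral_cong) (auto simp: sw_def c(3) local_cost_sym[OF assms])
  finally show False using \<pi>(2) by simp
qed

lemma transport_cost_sym:
  assumes "disk_density \<mu>" "disk_density \<nu>"
  shows "transport_cost R \<nu> \<mu> = transport_cost R \<mu> \<nu>"
  by (rule antisym[OF transport_cost_sym_le[OF assms] transport_cost_sym_le[OF assms(2,1)]])

section \<open>Gluing of plans and the triangle inequality\<close>

text \<open>The set \<open>?O\<close> is open and contains the diagonal, so for every
  \<open>y\<close> in the disk some center \<open>c n\<close> from a countable dense set satisfies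
  \<open>(c n, y) \<in> ?O\<close>. The least such \<open>n\<close> is the cell of \<open>y\<close>;
  two points of one cell are joined through the common center, which costs \<open>e/2\<close>
  twice.\<close>

lemma small_cells:
  assumes "disk_density \<nu>" "e > 0"
  shows "\<exists>i :: complex \<Rightarrow> nat. i \<in> measurable vol_H (count_space UNIV) \<and>
    (\<forall>y\<in>disk. \<forall>y'\<in>disk. i y = i y' \<longrightarrow> local_cost R \<nu> \<nu> y y' < e)"
proof -
  let ?O = "{p \<in> disk \<times> disk. local_cost R \<nu> \<nu> (fst p) (snd p) < e/2}"
  have O: "open ?O" by (rule open_local_cost_less[OF assms(1,1)])
  obtain S :: "complex set" where S: "countable S" "\<And>X. open X \<Longrightarrow> X \<noteq> {} \<Longrightarrow> \<exists>d\<in>S. d \<in> X"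
    using countable_dense_setE by blast
  then have "S \<noteq> {}" by (metis UNIV_not_empty empty_iff open_UNIV)
  define c where "c = from_nat_into S"
  define i where "i y = (LEAST n. (c n, y) \<in> ?O)" for y
  have ex: "\<exists>n. (c n, y) \<in> ?O" if y: "y \<in> disk" for y
  proof -
    have "(y, y) \<in> ?O"
      using local_cost_moebius[OF moebius_disk_id, of \<nu> \<nu> y R] y assms(2) by simp
    moreover have "open ((\<lambda>z. (z, y)) -` ?O)"
      by (rule open_vimage[OF O]) (intro continuous_intros)
    ultimately have "\<exists>d\<in>S. d \<in> (\<lambda>z. (z, y)) -` ?O" by (intro S(2)) blast+
    then obtain d where d: "d \<in> S" "(d, y) \<in> ?O" by (simp only: vimage_eq) blast
    obtain n where "c n = d" using from_nat_into_surj[OF S(1) d(1)] unfolding c_def by blast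
    with d(2) have "(c n, y) \<in> ?O" by (simp only:)
    then show ?thesis ..
  qed
  have "i \<in> measurable vol_H (count_space UNIV)"
    unfolding i_def
  proof (rule measurable_Least)
    fix n
    have "open ((\<lambda>y. (c n, y)) -` ?O)"
      by (rule open_vimage[OF O]) (intro continuous_intros)
    then have "(\<lambda>y. y \<in> (\<lambda>y. (c n, y)) -` ?O) \<in> measurable borel (count_space UNIV)"
      unfolding pred_def by (simp only: space_borel UNIV_I simp_thms Collect_mem_eq borel_open)
    then have "(\<lambda>y. (c n, y) \<in> ?O) \<in> measurable borel (count_space UNIV)" by (simp only: vimage_eq)
    then have "(\<lambda>y. (c n, y) \<in> ?O) \<in> measurable (restrict_space borel disk) (count_space UNIV)"
      by (rule measurable_restrict_space1)
    then show "(\<lambda>y. (c n, y) \<in> ?O) \<in> measurable vol_H (count_space UNIV)"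
      by (simp only: measurable_cong_sets[OF sets_vol_H refl])
  qed
  moreover have "local_cost R \<nu> \<nu> y y' < e" if y: "y \<in> disk" "y' \<in> disk" "i y = i y'" for y y'
  proof -
    have "(c (i y), y) \<in> ?O" unfolding i_def by (rule LeastI_ex[OF ex[OF y(1)]])
    moreover have "(c (i y), y') \<in> ?O" unfolding y(3) unfolding i_def by (rule LeastI_ex[OF ex[OF y(2)]])
    ultimately have c: "c (i y) \<in> disk" "local_cost R \<nu> \<nu> (c (i y)) y < e/2" "local_cost R \<nu> \<nu> (c (i y)) y' < e/2"
      by auto
    have "local_cost R \<nu> \<nu> y y' \<le> local_cost R \<nu> \<nu> y (c (i y)) + local_cost R \<nu> \<nu> (c (i y)) y'"
      using local_cost_triangle[OF assms(1,1,1) y(1) c(1) y(2)] .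
    then show ?thesis using local_cost_sym[OF assms(1,1) y(1) c(1), of R] c(2,3) by linarith
  qed
  ultimately show ?thesis by (intro exI[of _ i]) simp
qed

text \<open>\<open>\<Gamma>\<close> couples the two plans themselves, so its points are
  \<open>((x, y), (y', z))\<close> with \<open>y\<close> and \<open>y'\<close> almost surely in one
  cell. Of the error \<open>e\<close>, one third goes to the near-optimality of each plan and one
  third to \<open>local_cost R \<nu> \<nu> y y'\<close>.\<close>

lemma transport_cost_triangle:
  assumes "disk_density \<mu>" "disk_density \<nu>" "disk_density \<rho>"
  shows "transport_cost R \<mu> \<rho> \<le> transport_cost R \<mu> \<nu> + transport_cost R \<nu> \<rho>"
proof (rule field_le_epsilon)
  fix e :: real assume "e > 0"
  then have e3: "e / 3 > 0" by simp
  obtain \<pi>1 where \<pi>1: "\<pi>1 \<in> couplings \<mu> \<nu>" "coupling_cost R \<mu> \<nu> \<pi>1 < transport_cost R \<mu> \<nu> + e/3"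
    using transport_cost_lessE[OF assms(1,2), of R "transport_cost R \<mu> \<nu> + e/3"] e3 by auto
  obtain \<pi>2 where \<pi>2: "\<pi>2 \<in> couplings \<nu> \<rho>" "coupling_cost R \<nu> \<rho> \<pi>2 < transport_cost R \<nu> \<rho> + e/3"
    using transport_cost_lessE[OF assms(2,3), of R "transport_cost R \<nu> \<rho> + e/3"] e3 by auto
  note c1 = couplingsD[OF \<pi>1(1)] and c2 = couplingsD[OF \<pi>2(1)]
  obtain i :: "complex \<Rightarrow> nat" where i: "i \<in> measurable vol_H (count_space UNIV)"
    "\<And>y y'. y \<in> disk \<Longrightarrow> y' \<in> disk \<Longrightarrow> i y = i y' \<Longrightarrow> local_cost R \<nu> \<nu> y y' < e/3"
    using small_cells[OF assms(2) e3, of R] by blast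
  have f: "i \<circ> snd \<in> measurable \<pi>1 (count_space UNIV)" and g: "i \<circ> fst \<in> measurable \<pi>2 (count_space UNIV)"
    using measurable_comp[OF c1(7) i(1)] measurable_comp[OF c2(6) i(1)] by auto
  \<comment> \<open>Both sides are the law of the cell index under
    \<open>density_measure \<nu>\<close>, the marginal that the two plans share.\<close>
  have "distr \<pi>1 (count_space UNIV) (i \<circ> snd) = distr \<pi>2 (count_space UNIV) (i \<circ> fst)"
    using distr_distr[OF i(1) c1(7)] distr_distr[OF i(1) c2(6)] c1(5) c2(4) by simp
  then obtain \<Gamma> where \<Gamma>: "sets \<Gamma> = sets (\<pi>1 \<Otimes>\<^sub>M \<pi>2)" "distr \<Gamma> \<pi>1 fst = \<pi>1" "distr \<Gamma> \<pi>2 snd = \<pi>2"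
    "AE w in \<Gamma>. (i \<circ> snd) (fst w) = (i \<circ> fst) (snd w)"
    using coupling_of_matching_partitions[OF c1(1) c2(1) f g] by blast
  have m1: "fst \<in> measurable \<Gamma> \<pi>1" and m2: "snd \<in> measurable \<Gamma> \<pi>2"
    by (simp_all add: measurable_cong_sets[OF \<Gamma>(1) refl])
  interpret \<pi>1: prob_space \<pi>1 by (rule c1(1))
  have "prob_space \<Gamma>"
  proof (rule prob_spaceI)
    have "emeasure \<Gamma> (space \<Gamma>) = emeasure (distr \<Gamma> \<pi>1 fst) (space \<pi>1)"
      using measurable_space[OF m1] by (subst emeasure_distr[OF m1]) (auto intro!: arg_cong2[where f=emeasure])
    then show "emeasure \<Gamma> (space \<Gamma>) = 1" by (simp add: \<Gamma>(2) \<pi>1.emeasure_space_1)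
  qed
  then interpret \<Gamma>: prob_space \<Gamma> .
  have sp: "space \<Gamma> = (disk \<times> disk) \<times> (disk \<times> disk)"
    using sets_eq_imp_space_eq[OF \<Gamma>(1)] by (simp add: space_pair_measure c1(3) c2(3))
  \<comment> \<open>Forgetting the two middle points turns \<open>\<Gamma>\<close> into a plan
    between \<open>\<mu>\<close> and \<open>\<rho>\<close>.\<close>
  define t where "t w = (fst (fst w), snd (snd w))" for w :: "(complex \<times> complex) \<times> (complex \<times> complex)"
  have ff: "(\<lambda>w. fst (fst w)) \<in> measurable \<Gamma> vol_H" and ss: "(\<lambda>w. snd (snd w)) \<in> measurable \<Gamma> vol_H"
    using measurable_compose[OF m1 c1(6)] measurable_compose[OF m2 c2(7)] by auto
  have t: "t \<in> measurable \<Gamma> (vol_H \<Otimes>\<^sub>M vol_H)"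
    unfolding t_def by (rule measurable_Pair[OF ff ss])
  define \<pi> where "\<pi> = distr \<Gamma> (vol_H \<Otimes>\<^sub>M vol_H) t"
  have "\<pi> \<in> couplings \<mu> \<rho>"
    unfolding couplings_def
  proof (intro CollectI conjI)
    show "prob_space \<pi>" unfolding \<pi>_def by (rule \<Gamma>.prob_space_distr[OF t])
    have "distr \<pi> vol_H fst = distr (distr \<Gamma> \<pi>1 fst) vol_H fst"
      unfolding \<pi>_def distr_distr[OF measurable_fst t] distr_distr[OF c1(6) m1] by (simp add: o_def t_def)
    then show "distr \<pi> vol_H fst = density_measure \<mu>" by (simp add: \<Gamma>(2) c1(4))
    have "distr \<pi> vol_H snd = distr (distr \<Gamma> \<pi>2 snd) vol_H snd"
      unfolding \<pi>_def distr_distr[OF measurable_snd t] distr_distr[OF c2(7) m2] by (simp add: o_def t_def)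
    then show "distr \<pi> vol_H snd = density_measure \<rho>" by (simp add: \<Gamma>(3) c2(5))
  qed (simp add: \<pi>_def)
  have "integrable (distr \<Gamma> \<pi>1 fst) (\<lambda>p. local_cost R \<mu> \<nu> (fst p) (snd p))"
    unfolding \<Gamma>(2) by (rule integrable_local_cost[OF assms(1,2) \<pi>1(1)])
  then have I1: "integrable \<Gamma> (\<lambda>w. local_cost R \<mu> \<nu> (fst (fst w)) (snd (fst w)))"
    by (rule integrable_distr[OF m1])
  have "integrable (distr \<Gamma> \<pi>2 snd) (\<lambda>p. local_cost R \<nu> \<rho> (fst p) (snd p))"
    unfolding \<Gamma>(3) by (rule integrable_local_cost[OF assms(2,3) \<pi>2(1)])
  then have I2: "integrable \<Gamma> (\<lambda>w. local_cost R \<nu> \<rho> (fst (snd w)) (snd (snd w)))"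
    by (rule integrable_distr[OF m2])
  have "transport_cost R \<mu> \<rho> \<le> coupling_cost R \<mu> \<rho> \<pi>"
    by (rule transport_cost_le[OF \<open>\<pi> \<in> couplings \<mu> \<rho>\<close>])
  also have "coupling_cost R \<mu> \<rho> \<pi> = (LINT w|\<Gamma>. local_cost R \<mu> \<rho> (fst (t w)) (snd (t w)))"
    unfolding coupling_cost_def \<pi>_def by (rule integral_distr[OF t borel_measurable_local_cost[OF assms(1,3)]])
  also have "\<dots> \<le> (LINT w|\<Gamma>. local_cost R \<mu> \<nu> (fst (fst w)) (snd (fst w)) + local_cost R \<nu> \<rho> (fst (snd w)) (snd (snd w)) + e/3)"
  proof (rule integral_mono_AE)
    have "integrable \<pi> (\<lambda>p. local_cost R \<mu> \<rho> (fst p) (snd p))"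
      by (rule integrable_local_cost[OF assms(1,3) \<open>\<pi> \<in> couplings \<mu> \<rho>\<close>])
    then show "integrable \<Gamma> (\<lambda>w. local_cost R \<mu> \<rho> (fst (t w)) (snd (t w)))"
      unfolding \<pi>_def by (rule integrable_distr[OF t])
    show "integrable \<Gamma> (\<lambda>w. local_cost R \<mu> \<nu> (fst (fst w)) (snd (fst w)) + local_cost R \<nu> \<rho> (fst (snd w)) (snd (snd w)) + e/3)"
      using I1 I2 by simp
    show "AE w in \<Gamma>. local_cost R \<mu> \<rho> (fst (t w)) (snd (t w)) \<le>
        local_cost R \<mu> \<nu> (fst (fst w)) (snd (fst w)) + local_cost R \<nu> \<rho> (fst (snd w)) (snd (snd w)) + e/3"
      using \<Gamma>(4)
    proof (rule AE_mp, intro AE_I2 impI)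
      fix w assume w: "w \<in> space \<Gamma>" "(i \<circ> snd) (fst w) = (i \<circ> fst) (snd w)"
      obtain x y y' z where wd: "w = ((x, y), (y', z))" by (metis prod.collapse)
      then have d: "x \<in> disk" "y \<in> disk" "y' \<in> disk" "z \<in> disk" using w(1) unfolding sp by auto
      have "local_cost R \<mu> \<rho> x z \<le> local_cost R \<mu> \<nu> x y + local_cost R \<nu> \<rho> y z"
        by (rule local_cost_triangle[OF assms d(1,2,4)])
      moreover have "local_cost R \<nu> \<rho> y z \<le> local_cost R \<nu> \<nu> y y' + local_cost R \<nu> \<rho> y' z"
        by (rule local_cost_triangle[OF assms(2,2,3) d(2,3,4)])
      moreover have "local_cost R \<nu> \<nu> y y' < e/3"
        using i(2)[OF d(2,3)] w(2) wd by simp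
      ultimately show "local_cost R \<mu> \<rho> (fst (t w)) (snd (t w)) \<le>
        local_cost R \<mu> \<nu> (fst (fst w)) (snd (fst w)) + local_cost R \<nu> \<rho> (fst (snd w)) (snd (snd w)) + e/3"
        by (simp add: wd t_def)
    qed
  qed
  also have "\<dots> = (LINT w|\<Gamma>. local_cost R \<mu> \<nu> (fst (fst w)) (snd (fst w)))
      + (LINT w|\<Gamma>. local_cost R \<nu> \<rho> (fst (snd w)) (snd (snd w))) + e/3"
    using I1 I2 by (simp add: \<Gamma>.prob_space)
  also have "(LINT w|\<Gamma>. local_cost R \<mu> \<nu> (fst (fst w)) (snd (fst w))) = coupling_cost R \<mu> \<nu> \<pi>1"
    unfolding coupling_cost_def
    using integral_distr[OF m1, of "\<lambda>p. local_cost R \<mu> \<nu> (fst p) (snd p)"] borel_measurable_local_cost[OF assms(1,2)]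
    by (simp add: \<Gamma>(2) measurable_cong_sets[OF c1(2) refl])
  also have "(LINT w|\<Gamma>. local_cost R \<nu> \<rho> (fst (snd w)) (snd (snd w))) = coupling_cost R \<nu> \<rho> \<pi>2"
    unfolding coupling_cost_def
    using integral_distr[OF m2, of "\<lambda>p. local_cost R \<nu> \<rho> (fst p) (snd p)"] borel_measurable_local_cost[OF assms(2,3)]
    by (simp add: \<Gamma>(3) measurable_cong_sets[OF c2(2) refl])
  finally show "transport_cost R \<mu> \<rho> \<le> transport_cost R \<mu> \<nu> + transport_cost R \<nu> \<rho> + e"
    using \<pi>1(2) \<pi>2(2) by (simp add: field_simps)
qed

lemma transport_cost_moebius:
  assumes "disk_density \<mu>" "disk_density \<nu>" "m \<in> moebius_disk" "\<And>z. z \<in> disk \<Longrightarrow> \<nu> (m z) = \<mu> z"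
  shows "transport_cost R \<mu> \<nu> = 0"
proof (rule antisym)
  interpret P: prob_space "density_measure \<mu>" by (rule prob_space_density_measure[OF assms(1)])
  have mm: "m \<in> measurable (density_measure \<mu>) vol_H"
    using moebius_disk_measurable[OF assms(3)] by (simp add: measurable_cong_sets[OF sets_density_measure refl])
  have idm: "(\<lambda>z. z) \<in> measurable (density_measure \<mu>) vol_H"
    by (simp add: measurable_cong_sets[OF sets_density_measure refl])
  define t where "t z = (z, m z)" for z
  have t: "t \<in> measurable (density_measure \<mu>) (vol_H \<Otimes>\<^sub>M vol_H)"
    unfolding t_def by (rule measurable_Pair[OF idm mm])
  define \<pi> where "\<pi> = distr (density_measure \<mu>) (vol_H \<Otimes>\<^sub>M vol_H) t"
  have \<nu>m: "(\<lambda>z. ennreal (\<nu> z)) \<in> borel_measurable vol_H"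
    using borel_measurable_integrable[OF disk_densityD(3)[OF assms(2)]] by measurable
  have \<mu>m: "(\<lambda>z. ennreal (\<mu> z)) \<in> borel_measurable vol_H"
    using borel_measurable_integrable[OF disk_densityD(3)[OF assms(1)]] by measurable
  \<comment> \<open>Since \<open>m\<close> preserves \<open>vol_H\<close>, it pushes the measure
    with density \<open>\<nu> \<circ> m\<close>, which is \<open>\<mu>\<close> on the disk, to the
    one with density \<open>\<nu>\<close>.\<close>
  have push: "distr (density_measure \<mu>) vol_H m = density_measure \<nu>"
  proof -
    have "density_measure \<nu> = density (distr vol_H vol_H m) (\<lambda>z. ennreal (\<nu> z))"
      by (simp add: density_measure_def distr_vol_H_moebius_disk[OF assms(3)])
    also have "\<dots> = distr (density vol_H (\<lambda>z. ennreal (\<nu> (m z)))) vol_H m"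
      by (rule density_distr[OF \<nu>m moebius_disk_measurable[OF assms(3)]])
    also have "density vol_H (\<lambda>z. ennreal (\<nu> (m z))) = density_measure \<mu>"
      unfolding density_measure_def
      by (rule density_cong[OF measurable_compose[OF moebius_disk_measurable[OF assms(3)] \<nu>m] \<mu>m])
         (use assms(4) in auto)
    finally show ?thesis by simp
  qed
  have "\<pi> \<in> couplings \<mu> \<nu>"
    unfolding couplings_def
  proof (intro CollectI conjI)
    show "prob_space \<pi>" unfolding \<pi>_def by (rule P.prob_space_distr[OF t])
    show "distr \<pi> vol_H fst = density_measure \<mu>"
      unfolding \<pi>_def distr_distr[OF measurable_fst t]
      by (simp add: o_def t_def distr_id2)
    show "distr \<pi> vol_H snd = density_measure \<nu>"
      unfolding \<pi>_def distr_distr[OF measurable_snd t] using push by (simp add: o_def t_def)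
  qed (simp add: \<pi>_def)
  then have "transport_cost R \<mu> \<nu> \<le> coupling_cost R \<mu> \<nu> \<pi>"
    by (rule transport_cost_le)
  also have "\<dots> = (LINT z|density_measure \<mu>. local_cost R \<mu> \<nu> (fst (t z)) (snd (t z)))"
    unfolding coupling_cost_def \<pi>_def by (rule integral_distr[OF t borel_measurable_local_cost[OF assms(1,2)]])
  also have "\<dots> = (LINT z|density_measure \<mu>. 0)"
    by (rule Bochner_Integration.integral_cong) (use local_cost_moebius[OF assms(3), of \<nu> \<mu>] assms(4) in \<open>auto simp: t_def\<close>)
  finally show "transport_cost R \<mu> \<nu> \<le> 0" by simp
qed (rule transport_cost_nonneg[OF assms(1,2)])

lemma transport_cost_cong_0:
  assumes "disk_density \<mu>" "disk_density \<mu>'" "disk_density \<nu>" "disk_density \<nu>'"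
    and "transport_cost R \<mu> \<mu>' = 0" "transport_cost R \<nu> \<nu>' = 0"
  shows "transport_cost R \<mu> \<nu> = transport_cost R \<mu>' \<nu>'"
  using transport_cost_triangle[OF assms(1,2,3), of R] transport_cost_triangle[OF assms(2,4,3), of R]
    transport_cost_triangle[OF assms(2,1,4), of R] transport_cost_triangle[OF assms(1,3,4), of R]
    transport_cost_sym[OF assms(1,2), of R] transport_cost_sym[OF assms(3,4), of R] assms(5,6)
  by linarith

section \<open>Conformal factors of a surface\<close>

abbreviation disk_weight :: "complex \<Rightarrow> real" where
  "disk_weight z \<equiv> 1 / (1 - (norm z)\<^sup>2)\<^sup>2"

lemma disk_weight_pos: "z \<in> disk \<Longrightarrow> disk_weight z > 0"
  by (auto simp: abs_square_eq_1 abs_square_less_1)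

text \<open>A first-order form of \<open>uniformization\<close> that composes well with isometries.\<close>

definition isometric_chart :: "'a surface \<Rightarrow> (complex \<Rightarrow> real) \<Rightarrow> ('a \<Rightarrow> complex) \<Rightarrow> bool" where
  "isometric_chart M \<mu> f \<longleftrightarrow> homeomorphic_map (stop M) (top_of_set disk) f \<and>
     (\<forall>c\<in>atlas M. \<forall>p\<in>fst c. \<exists>D. (f \<circ> inv_into (fst c) (snd c) has_derivative D) (at (snd c p)) \<and>
        plane_det D > 0 \<and> (\<forall>v w. \<mu> (f p) * disk_weight (f p) * (D v \<bullet> D w) = metric M c (snd c p) v w))"

section \<open>Conformal linear maps of the plane\<close>

lemma linear_plane_expand:
  assumes "linear (L :: complex \<Rightarrow> complex)"
  shows "L a = Re a *\<^sub>R L 1 + Im a *\<^sub>R L \<i>"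
proof -
  have "L a = L (Re a *\<^sub>R 1 + Im a *\<^sub>R \<i>)"
    by (rule arg_cong[of _ _ L]) (simp add: complex_eq_iff)
  then show ?thesis by (simp add: linear_add[OF assms] linear_scale[OF assms])
qed

lemma plane_det_comp:
  assumes "linear K" "linear L"
  shows "plane_det (K \<circ> L) = plane_det K * plane_det L"
proof -
  have "K (L 1) = Re (L 1) *\<^sub>R K 1 + Im (L 1) *\<^sub>R K \<i>" "K (L \<i>) = Re (L \<i>) *\<^sub>R K 1 + Im (L \<i>) *\<^sub>R K \<i>"
    using linear_plane_expand[OF assms(1)] by blast+
  then show ?thesis by (simp add: plane_det_def algebra_simps)
qed

text \<open>The columns \<open>(x, y)\<close> and \<open>(u, v)\<close> of \<open>L\<close> are
  orthogonal and of equal length. The Lagrange identity gives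
  \<open>(x * v - y * u)\<^sup>2 = (x * x + y * y)\<^sup>2\<close>, and the sign of the determinant
  selects the root that makes \<open>(u + y)\<^sup>2 + (v - x)\<^sup>2\<close> vanish; the other
  root would be the conjugate linear case.\<close>

lemma conformal_linear_is_complex_linear:
  assumes L: "linear L" and det: "plane_det L > 0" and k: "k > 0"
    and conf: "\<And>v w. k * (L v \<bullet> L w) = s * (v \<bullet> w)"
  shows "L a = L 1 * a"
proof -
  define x y u v where d: "x = Re (L 1)" "y = Im (L 1)" "u = Re (L \<i>)" "v = Im (L \<i>)"
  have "k * (x * u + y * v) = 0" "k * (x * x + y * y) = s" "k * (u * u + v * v) = s"
    using conf[of 1 \<i>] conf[of 1 1] conf[of \<i> \<i>] by (auto simp: inner_complex_def d)
  then have 1: "x * u + y * v = 0" and 2: "x * x + y * y = u * u + v * v"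
    using k by (auto simp: distrib_left[symmetric])
  have 3: "x * v - y * u > 0" using det by (simp add: plane_det_def d)
  have "(u + y)\<^sup>2 + (v - x)\<^sup>2 = 2 * (x * x + y * y - (x * v - y * u))"
    using 2 by (simp add: power2_eq_square algebra_simps)
  moreover have "(x * x + y * y)\<^sup>2 = (x * v - y * u)\<^sup>2"
  proof -
    have "(x * v - y * u)\<^sup>2 = (x * x + y * y) * (u * u + v * v) - (x * u + y * v)\<^sup>2"
      by (simp add: power2_eq_square algebra_simps)
    then show ?thesis using 1 2 by (simp add: power2_eq_square)
  qed
  then have "x * x + y * y = x * v - y * u"
    using 3 by (subst (asm) power2_eq_iff_nonneg) auto
  ultimately have "u = - y" "v = x"
    by (simp_all add: sum_power2_eq_zero_iff)
  then have "L \<i> = \<i> * L 1" by (simp add: complex_eq_iff d)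
  then show ?thesis
    using linear_plane_expand[OF L, of a] by (simp add: complex_eq_iff algebra_simps)
qed

section \<open>First-order data of uniformizations and isometries\<close>

lemma smooth_on_imp_has_derivative:
  assumes "smooth_on f S" "x \<in> S"
  shows "(f has_derivative frechet_derivative f (at x)) (at x)"
proof -
  have "Ck_on (Suc 0) f S" using assms(1) by (simp only: smooth_on_def)
  then show ?thesis using assms(2) by (simp add: frechet_derivative_works)
qed

lemma chart_props:
  assumes "riemannian_surface M" "c \<in> atlas M"
  shows "fst c \<subseteq> topspace (stop M)" "openin (stop M) (fst c)" "inj_on (snd c) (fst c)" "open (snd c ` fst c)"
    "\<And>p. p \<in> fst c \<Longrightarrow> inv_into (fst c) (snd c) (snd c p) = p"
    "\<And>W. openin (stop M) W \<Longrightarrow> W \<subseteq> fst c \<Longrightarrow> open (snd c ` W)"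
proof -
  have *: "openin (stop M) (fst c)" "open (snd c ` fst c)"
    "homeomorphic_map (subtopology (stop M) (fst c)) (top_of_set (snd c ` fst c)) (snd c)"
    using assms unfolding riemannian_surface_def by blast+
  show sub: "fst c \<subseteq> topspace (stop M)" using openin_subset[OF *(1)] .
  show "openin (stop M) (fst c)" "open (snd c ` fst c)" by fact+
  have ts: "topspace (subtopology (stop M) (fst c)) = fst c"
    using sub by (simp add: Int_absorb1)
  show inj: "inj_on (snd c) (fst c)"
    using homeomorphic_imp_injective_map[OF *(3)] by (simp only: ts)
  show "inv_into (fst c) (snd c) (snd c p) = p" if "p \<in> fst c" for p
    using inj that by simp
  show "open (snd c ` W)" if "openin (stop M) W" "W \<subseteq> fst c" for W
  proof -
    have "openin (subtopology (stop M) (fst c)) W"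
      using that by (auto simp: openin_subtopology)
    then have "openin (top_of_set (snd c ` fst c)) (snd c ` W)"
      using homeomorphic_imp_open_map[OF *(3)] unfolding open_map_def by blast
    then show ?thesis using *(2) openin_open_trans by blast
  qed
qed

lemma metric_pos:
  assumes "riemannian_surface M" "c \<in> atlas M" "p \<in> fst c" "v \<noteq> 0"
  shows "metric M c (snd c p) v v > 0"
proof -
  have "\<forall>z\<in>snd c ` fst c. \<forall>v. v \<noteq> 0 \<longrightarrow> metric M c z v v > 0"
    using assms(1,2) unfolding riemannian_surface_def by blast
  then show ?thesis using assms(3,4) by blast
qed

lemma uniformization_imp_isometric_chart:
  assumes M: "riemannian_surface M" and u: "uniformization M \<mu> f"
  shows "isometric_chart M \<mu> f"
proof -
  let ?d = "(disk, id) :: complex chart"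
  have iso: "isometry M (disk_surface \<mu>) f" using u by (simp add: uniformization_def)
  then have od: "oriented_diffeo M (disk_surface \<mu>) f" by (simp add: isometry_def)
  have hm: "homeomorphic_map (stop M) (top_of_set disk) f"
    using od by (simp add: oriented_diffeo_def disk_surface_def)
  have fd: "f p \<in> disk" if "p \<in> topspace (stop M)" for p
    using homeomorphic_imp_surjective_map[OF hm] that by auto
  show ?thesis
    unfolding isometric_chart_def
  proof (intro conjI ballI hm)
    fix c p assume c: "c \<in> atlas M" and p: "p \<in> fst c"
    note cp = chart_props[OF M c]
    let ?F = "f \<circ> inv_into (fst c) (snd c)"
    have d: "?d \<in> atlas (disk_surface \<mu>)" by (simp add: disk_surface_def)
    have rep: "local_rep c f ?d = ?F" by (simp add: local_rep_def)
    have z: "snd c p \<in> local_dom c f ?d"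
      using p fd cp(1) unfolding local_dom_def by auto
    let ?D = "frechet_derivative ?F (at (snd c p))"
    have "smooth_on ?F (local_dom c f ?d)" "plane_det ?D > 0"
      using od c d z unfolding oriented_diffeo_def rep[symmetric] by blast+
    then have "(?F has_derivative ?D) (at (snd c p))" "plane_det ?D > 0"
      using smooth_on_imp_has_derivative z by blast+
    moreover have "\<mu> (f p) * disk_weight (f p) * (?D v \<bullet> ?D w) = metric M c (snd c p) v w" for v w
    proof -
      have "pullback_metric (disk_surface \<mu>) f c ?d (snd c p) v w = metric M c (snd c p) v w"
        using iso c d z unfolding isometry_def by blast
      then show ?thesis
        by (simp add: pullback_metric_def rep Let_def disk_surface_def cp(5)[OF p])
    qed
    ultimately show "\<exists>D. (?F has_derivative D) (at (snd c p)) \<and> plane_det D > 0 \<and>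
       (\<forall>v w. \<mu> (f p) * disk_weight (f p) * (D v \<bullet> D w) = metric M c (snd c p) v w)" by blast
  qed
qed

text \<open>The chain rule at one point: near \<open>snd c p\<close> the map
  \<open>g \<circ> k\<close> is \<open>g\<close> in a chart of \<open>N\<close> after the local
  representative of \<open>k\<close>. Determinants multiply, and the metric of \<open>N\<close>
  pulls back to that of \<open>M\<close>.\<close>

lemma isometric_chart_comp_isometry:
  assumes M: "riemannian_surface M" and N: "riemannian_surface N"
    and k: "isometry M N k" and g: "isometric_chart N \<nu> g"
  shows "isometric_chart M \<nu> (g \<circ> k)"
proof -
  have od: "oriented_diffeo M N k" using k by (simp add: isometry_def)
  have hm: "homeomorphic_map (stop M) (stop N) k" using od by (simp add: oriented_diffeo_def)
  have hg: "homeomorphic_map (stop N) (top_of_set disk) g" using g by (simp add: isometric_chart_def)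
  show ?thesis
    unfolding isometric_chart_def
  proof (intro conjI ballI homeomorphic_map_compose[OF hm hg])
    fix c p assume c: "c \<in> atlas M" and p: "p \<in> fst c"
    note cp = chart_props[OF M c]
    let ?\<psi> = "inv_into (fst c) (snd c)"
    have "k p \<in> topspace (stop N)"
      using homeomorphic_imp_surjective_map[OF hm] cp(1) p by auto
    moreover have "(\<Union>c\<in>atlas N. fst c) = topspace (stop N)"
      using N unfolding riemannian_surface_def by blast
    ultimately have "k p \<in> (\<Union>c\<in>atlas N. fst c)" by simp
    then obtain c' where c': "c' \<in> atlas N" and kp: "k p \<in> fst c'" by blast
    note cp' = chart_props[OF N c']
    let ?\<psi>' = "inv_into (fst c') (snd c')"
    let ?K = "local_rep c k c'" and ?X = "local_dom c k c'" and ?z = "snd c p"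
    let ?DK = "frechet_derivative ?K (at ?z)"
    have z: "?z \<in> ?X" using p kp unfolding local_dom_def by auto
    have "smooth_on ?K ?X" and detK: "plane_det ?DK > 0"
      using od c c' z unfolding oriented_diffeo_def by blast+
    then have DK: "(?K has_derivative ?DK) (at ?z)"
      using smooth_on_imp_has_derivative z by blast
    have Kz: "?K ?z = snd c' (k p)" by (simp add: local_rep_def cp(5)[OF p])
    obtain D where D: "(g \<circ> ?\<psi>' has_derivative D) (at (snd c' (k p)))" "plane_det D > 0"
      "\<And>v w. \<nu> (g (k p)) * disk_weight (g (k p)) * (D v \<bullet> D w) = metric N c' (snd c' (k p)) v w"
      using g c' kp unfolding isometric_chart_def by blast
    \<comment> \<open>The two expressions for \<open>g \<circ> k\<close> agree on \<open>?X\<close>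
      only, so \<open>?X\<close> has to be a neighborhood of the point for the derivative to carry
      over.\<close>
    have X: "open ?X"
      unfolding local_dom_def
    proof (rule cp(6))
      have "openin (stop M) {x \<in> topspace (stop M). k x \<in> fst c'}"
        using openin_continuous_map_preimage[OF homeomorphic_imp_continuous_map[OF hm] cp'(2)] .
      then have "openin (stop M) (fst c \<inter> {x \<in> topspace (stop M). k x \<in> fst c'})"
        using cp(2) by (rule openin_Int[rotated])
      moreover have "fst c \<inter> {x \<in> topspace (stop M). k x \<in> fst c'} = fst c \<inter> k -` fst c'"
        using cp(1) by auto
      ultimately show "openin (stop M) (fst c \<inter> k -` fst c')" by simp
    qed auto
    have "((g \<circ> ?\<psi>') \<circ> ?K has_derivative D \<circ> ?DK) (at ?z)"
      by (rule diff_chain_at[OF DK]) (simp only: Kz D(1))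
    then have "(g \<circ> k \<circ> ?\<psi> has_derivative D \<circ> ?DK) (at ?z)"
    proof (rule has_derivative_transform_within_open[OF _ X z])
      fix x assume "x \<in> ?X"
      then obtain q where "q \<in> fst c" "k q \<in> fst c'" "x = snd c q" unfolding local_dom_def by auto
      then show "(g \<circ> ?\<psi>' \<circ> ?K) x = (g \<circ> k \<circ> ?\<psi>) x"
        by (simp add: local_rep_def cp(5) cp'(5))
    qed
    moreover have "plane_det (D \<circ> ?DK) > 0"
      using detK D(2) plane_det_comp[OF has_derivative_linear[OF D(1)] has_derivative_linear[OF DK]] by simp
    moreover have "\<nu> ((g \<circ> k) p) * disk_weight ((g \<circ> k) p) * ((D \<circ> ?DK) v \<bullet> (D \<circ> ?DK) w) = metric M c ?z v w" for v w
    proof -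
      have "pullback_metric N k c c' ?z v w = metric M c ?z v w"
        using k c c' z unfolding isometry_def by blast
      then show ?thesis using D(3)[of "?DK v" "?DK w"]
        by (simp add: pullback_metric_def Let_def Kz)
    qed
    ultimately show "\<exists>D. (g \<circ> k \<circ> ?\<psi> has_derivative D) (at ?z) \<and> plane_det D > 0 \<and>
       (\<forall>v w. \<nu> ((g \<circ> k) p) * disk_weight ((g \<circ> k) p) * (D v \<bullet> D w) = metric M c ?z v w)" by blast
  qed
qed

text \<open>In a chart around \<open>p\<close> the derivatives \<open>D\<close> of \<open>f\<close>
  and \<open>E\<close> of \<open>g\<close> pull two conformal inner products back to the same one,
  the metric of \<open>M\<close>. Hence \<open>E \<circ> D'\<close>, with \<open>D'\<close> inverse
  to \<open>D\<close>, is conformal with positive determinant and so complex linear; its scale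
  relates the two conformal factors.\<close>

lemma transition_has_field_derivative:
  assumes M: "riemannian_surface M" and f: "isometric_chart M \<mu> f" and g: "isometric_chart M \<nu> g"
    and pos: "\<And>z. z \<in> disk \<Longrightarrow> \<nu> z > 0" and q: "q \<in> disk"
  defines "h \<equiv> g \<circ> inv_into (topspace (stop M)) f"
  obtains e where "(h has_field_derivative e) (at q)"
    "\<nu> (h q) * disk_weight (h q) * (norm e)\<^sup>2 = \<mu> q * disk_weight q"
proof -
  let ?T = "topspace (stop M)"
  have hf: "homeomorphic_map (stop M) (top_of_set disk) f" and hg: "homeomorphic_map (stop M) (top_of_set disk) g"
    using f g by (auto simp: isometric_chart_def)
  have injf: "inj_on f ?T" and sf: "f ` ?T = disk"
    using homeomorphic_imp_injective_map[OF hf] homeomorphic_imp_surjective_map[OF hf] by auto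
  have sg: "g ` ?T = disk" using homeomorphic_imp_surjective_map[OF hg] by auto
  have "q \<in> f ` ?T" using q by (simp only: sf)
  then obtain p where p: "p \<in> ?T" "f p = q" by blast
  have "(\<Union>c\<in>atlas M. fst c) = ?T" using M unfolding riemannian_surface_def by blast
  then have "p \<in> (\<Union>c\<in>atlas M. fst c)" using p(1) by simp
  then obtain c where c: "c \<in> atlas M" and pc: "p \<in> fst c" by blast
  note cp = chart_props[OF M c]
  let ?U = "fst c" and ?\<phi> = "snd c" and ?\<psi> = "inv_into (fst c) (snd c)" and ?fi = "inv_into ?T f"
  have fi: "?fi (f x) = x" if "x \<in> ?T" for x using injf that by simp
  let ?F = "f \<circ> ?\<psi>" and ?G = "g \<circ> ?\<psi>" and ?z = "snd c p"
  obtain D where D: "(?F has_derivative D) (at ?z)" "plane_det D > 0"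
    "\<And>v w. \<mu> q * disk_weight q * (D v \<bullet> D w) = metric M c ?z v w"
    using f c pc p(2) unfolding isometric_chart_def by blast
  obtain E where E: "(?G has_derivative E) (at ?z)" "plane_det E > 0"
    "\<And>v w. \<nu> (g p) * disk_weight (g p) * (E v \<bullet> E w) = metric M c ?z v w"
    using g c pc unfolding isometric_chart_def by blast
  have linD: "linear D" and linE: "linear E" using D(1) E(1) has_derivative_linear by blast+
  have "inj D"
  proof (subst linear_injective_0[OF linD], intro allI impI)
    fix v assume "D v = 0"
    then have "metric M c ?z v v = 0" using D(3)[of v v] by simp
    then show "v = 0" using metric_pos[OF M c pc, of v] by force
  qed
  then obtain D' where D': "linear D'" "D' \<circ> D = id"
    using linear_injective_left_inverse[OF linD] by blast
  then have DD': "D \<circ> D' = id" using linear_inverse_left[OF linD D'(1)] by simp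
  have contF: "continuous_on (?\<phi> ` ?U) ?F"
  proof (rule continuous_at_imp_continuous_on, rule ballI)
    fix x assume "x \<in> ?\<phi> ` ?U"
    then obtain y where y: "y \<in> ?U" "x = ?\<phi> y" by blast
    then obtain L where "(?F has_derivative L) (at x)" using f c unfolding isometric_chart_def by blast
    then show "isCont ?F x" by (rule has_derivative_continuous)
  qed
  have Fz: "?F ?z = q" by (simp add: cp(5)[OF pc] p(2))
  \<comment> \<open>This inverse function theorem asks for a derivative at one point, continuity on
    an open set and a left inverse there; the first-order data provide all three.\<close>
  have "(?\<phi> \<circ> ?fi has_derivative D') (at (?F ?z))"
  proof (rule has_derivative_inverse_strong[OF cp(4) _ contF _ D(1) DD'])
    show "?z \<in> ?\<phi> ` ?U" using pc by blast
    show "(?\<phi> \<circ> ?fi) (?F x) = x" if x: "x \<in> ?\<phi> ` ?U" for x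
    proof -
      obtain y where y: "y \<in> ?U" "x = ?\<phi> y" using x by blast
      then have "y \<in> ?T" using cp(1) by blast
      then show ?thesis using y by (simp add: cp(5) fi)
    qed
  qed
  then have inv: "(?\<phi> \<circ> ?fi has_derivative D') (at q)" by (simp only: Fz)
  have "(?\<phi> \<circ> ?fi) q = ?z" using fi[OF p(1)] p(2) by simp
  with E(1) have "(?G has_derivative E) (at ((?\<phi> \<circ> ?fi) q))" by simp
  then have "(?G \<circ> (?\<phi> \<circ> ?fi) has_derivative E \<circ> D') (at q)"
    by (rule diff_chain_at[OF inv])
  then have hd: "(h has_derivative E \<circ> D') (at q)"
  proof (rule has_derivative_transform_within_open)
    have "openin (top_of_set disk) (f ` ?U)"
      using homeomorphic_imp_open_map[OF hf] cp(2) unfolding open_map_def by blast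
    then show "open (f ` ?U)" using openin_open_trans open_ball by blast
    show "q \<in> f ` ?U" using pc p(2) by blast
    fix x assume "x \<in> f ` ?U"
    then obtain y where y: "y \<in> ?U" "x = f y" by blast
    then have "y \<in> ?T" using cp(1) by blast
    then show "(?G \<circ> (?\<phi> \<circ> ?fi)) x = h x" using y by (simp add: h_def fi cp(5))
  qed
  define L where "L = E \<circ> D'"
  have linL: "linear L" unfolding L_def by (rule linear_compose[OF D'(1) linE])
  have LD: "L \<circ> D = E" using D'(2) by (simp add: L_def comp_assoc)
  have detL: "plane_det L > 0"
  proof -
    have "plane_det E = plane_det L * plane_det D" using plane_det_comp[OF linL linD] LD by simp
    then show ?thesis using D(2) E(2) by (metis zero_less_mult_pos2)
  qed
  have hq: "h q = g p" using fi[OF p(1)] p(2) by (simp add: h_def)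
  have gp: "g p \<in> disk" using sg p(1) by blast
  have conf: "\<nu> (g p) * disk_weight (g p) * (L v \<bullet> L w) = \<mu> q * disk_weight q * (v \<bullet> w)" for v w
  proof -
    have "D (D' v) = v" "D (D' w) = w" using DD' by (metis comp_apply id_apply)+
    then show ?thesis using D(3)[of "D' v" "D' w"] E(3)[of "D' v" "D' w"] by (simp add: L_def)
  qed
  have k: "\<nu> (g p) * disk_weight (g p) > 0"
    by (rule mult_pos_pos[OF pos[OF gp] disk_weight_pos[OF gp]])
  have La: "L a = L 1 * a" for a
    by (rule conformal_linear_is_complex_linear[OF linL detL k conf])
  have "L = (\<lambda>a. L 1 * a)" using La by blast
  then have "(h has_field_derivative L 1) (at q)"
    using hd unfolding has_field_derivative_def L_def[symmetric] by simp
  moreover have "\<nu> (h q) * disk_weight (h q) * (norm (L 1))\<^sup>2 = \<mu> q * disk_weight q"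
    using conf[of 1 1] by (simp add: hq power2_norm_eq_inner[symmetric])
  ultimately show ?thesis using that by blast
qed

text \<open>The transition map \<open>h\<close> and its inverse \<open>h'\<close> are both
  holomorphic by the previous lemma with the roles of \<open>f\<close> and \<open>g\<close>
  exchanged, hence positivity of both densities.\<close>

lemma isometric_charts_differ_by_moebius:
  assumes M: "riemannian_surface M" and f: "isometric_chart M \<mu> f" and g: "isometric_chart M \<nu> g"
    and pos: "\<And>z. z \<in> disk \<Longrightarrow> \<mu> z > 0" "\<And>z. z \<in> disk \<Longrightarrow> \<nu> z > 0"
  obtains m where "m \<in> moebius_disk" "\<And>z. z \<in> disk \<Longrightarrow> \<nu> (m z) = \<mu> z"
proof -
  let ?T = "topspace (stop M)"
  define h where "h = g \<circ> inv_into ?T f"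
  define h' where "h' = f \<circ> inv_into ?T g"
  have hf: "homeomorphic_map (stop M) (top_of_set disk) f" and hg: "homeomorphic_map (stop M) (top_of_set disk) g"
    using f g by (auto simp: isometric_chart_def)
  have bf: "bij_betw f ?T disk" and bg: "bij_betw g ?T disk"
    using homeomorphic_imp_injective_map[OF hf] homeomorphic_imp_surjective_map[OF hf]
      homeomorphic_imp_injective_map[OF hg] homeomorphic_imp_surjective_map[OF hg]
    unfolding bij_betw_def by simp_all
  have fi: "inv_into ?T f z \<in> ?T" "f (inv_into ?T f z) = z" if "z \<in> disk" for z
    using bf that by (metis bij_betw_imp_surj_on inv_into_into, metis bij_betw_inv_into_right)
  have gi: "inv_into ?T g z \<in> ?T" "g (inv_into ?T g z) = z" if "z \<in> disk" for z
    using bg that by (metis bij_betw_imp_surj_on inv_into_into, metis bij_betw_inv_into_right)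
  have "disk_automorphism h"
    unfolding disk_automorphism_def
  proof (intro conjI exI[of _ h'] ballI)
    show "h holomorphic_on disk"
    proof (rule holomorphic_onI)
      fix q :: complex assume q: "q \<in> disk"
      obtain e where "(h has_field_derivative e) (at q)"
        using transition_has_field_derivative[OF M f g pos(2) q] unfolding h_def by blast
      then show "h field_differentiable at q within disk"
        using field_differentiable_at_within field_differentiable_def by blast
    qed
    show "h' holomorphic_on disk"
    proof (rule holomorphic_onI)
      fix q :: complex assume q: "q \<in> disk"
      obtain e where "(h' has_field_derivative e) (at q)"
        using transition_has_field_derivative[OF M g f pos(1) q] unfolding h'_def by blast
      then show "h' field_differentiable at q within disk"
        using field_differentiable_at_within field_differentiable_def by blast
    qed
    show "h \<in> disk \<rightarrow> disk" "h' \<in> disk \<rightarrow> disk"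
      unfolding h_def h'_def using fi(1) gi(1) bf bg by (auto simp: bij_betw_def simp del: mem_ball_0)
    show "h (h' z) = z" "h' (h z) = z" if "z \<in> disk" for z
      unfolding h_def h'_def using fi[OF that] gi[OF that] bf bg
      by (simp_all add: bij_betw_inv_into_left)
  qed
  then obtain m where m: "m \<in> moebius_disk" "\<And>z. z \<in> disk \<Longrightarrow> m z = h z"
    using disk_automorphism_is_moebius by blast
  have "\<nu> (m q) = \<mu> q" if q: "q \<in> disk" for q
  proof -
    obtain e where e: "(h has_field_derivative e) (at q)"
      "\<nu> (h q) * disk_weight (h q) * (norm e)\<^sup>2 = \<mu> q * disk_weight q"
      using transition_has_field_derivative[OF M f g pos(2) q] unfolding h_def by blast
    have "(m has_field_derivative e) (at q)"
      by (rule has_field_derivative_transform_within_open[OF e(1) open_ball q]) (simp add: m(2))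
    then have "deriv m q = e" by (rule DERIV_imp_deriv)
    \<comment> \<open>For a Moebius transformation the squared derivative is the quotient of the
      hyperbolic weights; inserted into \<open>e(2)\<close> it leaves the equality of the
      densities.\<close>
    then have "(norm e)\<^sup>2 * disk_weight (m q) = disk_weight q"
      using moebius_disk_derivative[OF m(1) q] by simp
    then have "\<nu> (m q) * disk_weight q = \<mu> q * disk_weight q"
      using e(2) m(2)[OF q] by (metis mult.assoc mult.commute)
    then show ?thesis using disk_weight_pos[OF q] by (metis less_irrefl mult_right_cancel)
  qed
  then show ?thesis using that m(1) by blast
qed

section \<open>Pushed-forward densities and independence of the conformal factors\<close>

lemma pushforward_moebius_disk:
  assumes "m \<in> moebius_disk" "z \<in> disk"
  shows "pushforward m \<mu> (m z) = \<mu> z"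
  using bij_betw_inv_into_left[OF moebius_disk_bij[OF assms(1)] assms(2)] by (simp add: pushforward_def)

text \<open>On the disk the pushforward is \<open>\<mu> \<circ> n\<close> with \<open>n\<close> a
  Moebius inverse of \<open>m\<close>. Outside, \<open>inv_into disk m\<close> is unspecified, so
  each property is transferred by congruence on the disk.\<close>

lemma disk_density_pushforward:
  assumes "disk_density \<mu>" "m \<in> moebius_disk"
  shows "disk_density (pushforward m \<mu>)"
proof -
  obtain n where n: "n \<in> moebius_disk" "\<And>z. z \<in> disk \<Longrightarrow> n (m z) = z" "\<And>z. z \<in> disk \<Longrightarrow> m (n z) = z"
    using moebius_disk_inverse[OF assms(2)] by blast
  have eq: "pushforward m \<mu> z = \<mu> (n z)" if "z \<in> disk" for z
    using pushforward_moebius_disk[OF assms(2) moebius_disk_mem[OF n(1) that], of \<mu>] n(3)[OF that] by simp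
  have im: "n ` disk \<subseteq> disk" using moebius_disk_mem[OF n(1)] by blast
  have "continuous_on disk (\<lambda>z. \<mu> (n z))"
    by (rule continuous_on_compose2[OF disk_densityD(1)[OF assms(1)] moebius_disk_continuous[OF n(1)] im])
  then have "continuous_on disk (pushforward m \<mu>)"
    by (rule continuous_on_eq) (simp add: eq)
  moreover have "pushforward m \<mu> z > 0" if "z \<in> disk" for z
    unfolding eq[OF that] by (rule disk_densityD(2)[OF assms(1) moebius_disk_mem[OF n(1) that]])
  moreover have "has_bochner_integral vol_H (pushforward m \<mu>) 1"
  proof -
    have "has_bochner_integral vol_H (\<lambda>z. \<mu> (n z)) 1"
      unfolding has_bochner_integral_iff
      using integrable_vol_H_moebius_disk[OF n(1) disk_densityD(3)[OF assms(1)]]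
        integral_vol_H_moebius_disk[OF n(1) borel_measurable_integrable[OF disk_densityD(3)[OF assms(1)]]]
        disk_densityD(4)[OF assms(1)] by simp
    then show ?thesis
      by (subst has_bochner_integral_cong[OF refl _ refl, of _ _ "\<lambda>z. \<mu> (n z)"]) (use eq in simp_all)
  qed
  ultimately show ?thesis unfolding disk_density_def by blast
qed

lemma conformal_factorsD:
  assumes "riemannian_surface M" "\<mu> \<in> conformal_factors M"
  obtains f where "disk_density \<mu>" "isometric_chart M \<mu> f"
  using assms uniformization_imp_isometric_chart hyperbolic_density_imp_disk_density
  unfolding conformal_factors_def by blast

text \<open>Composing the chart of \<open>N\<close> with \<open>k\<close> yields a second chart of
  the same surface \<open>M\<close>. The case \<open>k = id\<close> compares two conformal factors
  of one surface.\<close>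

lemma transport_cost_isometric:
  assumes "riemannian_surface M" "riemannian_surface N" "isometry M N k"
    and "\<mu> \<in> conformal_factors M" "\<nu> \<in> conformal_factors N"
  shows "transport_cost R \<mu> \<nu> = 0"
proof -
  obtain f where f: "disk_density \<mu>" "isometric_chart M \<mu> f"
    using conformal_factorsD[OF assms(1,4)] by blast
  obtain g where g: "disk_density \<nu>" "isometric_chart N \<nu> g"
    using conformal_factorsD[OF assms(2,5)] by blast
  obtain m where "m \<in> moebius_disk" "\<And>z. z \<in> disk \<Longrightarrow> \<nu> (m z) = \<mu> z"
    using isometric_charts_differ_by_moebius[OF assms(1) f(2) isometric_chart_comp_isometry[OF assms(1-3) g(2)]
        disk_densityD(2)[OF f(1)] disk_densityD(2)[OF g(1)]] by blast
  then show ?thesis by (rule transport_cost_moebius[OF f(1) g(1)])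
qed

lemma surface_dist_eq:
  assumes "M \<in> disk_type_surfaces" "N \<in> disk_type_surfaces"
    and "\<mu> \<in> conformal_factors M" "\<nu> \<in> conformal_factors N"
  shows "surface_dist R M N = transport_cost R \<mu> \<nu>"
proof -
  have r: "riemannian_surface M" "riemannian_surface N"
    using assms(1,2) by (auto simp: disk_type_surfaces_def)
  then have i: "isometry M M id" "isometry N N id" by (auto simp: riemannian_surface_def)
  have d: "disk_density \<mu>" if "\<mu> \<in> conformal_factors X" for \<mu> and X :: "'c surface"
    using that hyperbolic_density_imp_disk_density by (auto simp: conformal_factors_def)
  define \<mu>' where "\<mu>' = (SOME \<mu>. \<mu> \<in> conformal_factors M)"
  define \<nu>' where "\<nu>' = (SOME \<nu>. \<nu> \<in> conformal_factors N)"
  \<comment> \<open>The given factors witness nonemptiness, so \<open>SOME\<close> selects genuine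
    conformal factors.\<close>
  have s: "\<mu>' \<in> conformal_factors M" "\<nu>' \<in> conformal_factors N"
    unfolding \<mu>'_def \<nu>'_def some_in_eq using assms(3,4) by blast+
  have "transport_cost R \<mu>' \<nu>' = transport_cost R \<mu> \<nu>"
    using transport_cost_isometric[OF r(1) r(1) i(1) s(1) assms(3)]
      transport_cost_isometric[OF r(2) r(2) i(2) s(2) assms(4)]
    by (rule transport_cost_cong_0[OF d[OF s(1)] d[OF assms(3)] d[OF s(2)] d[OF assms(4)]])
  then show ?thesis by (simp add: surface_dist_def \<mu>'_def \<nu>'_def)
qed

theorem theorem3p11:
  fixes R :: real
  assumes "R > 0"
  shows
    "(\<forall>M\<in>(disk_type_surfaces :: 'a surface set). \<forall>N\<in>(disk_type_surfaces :: 'a surface set).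
        \<forall>\<mu>\<in>conformal_factors M. \<forall>\<nu>\<in>conformal_factors N.
          surface_dist R M N = transport_cost R \<mu> \<nu>) \<and>
     semi_metric_on (disk_type_surfaces :: 'a surface set) isometric (surface_dist R) \<and>
     (\<forall>\<mu> m. hyperbolic_density \<mu> \<and> m \<in> moebius_disk \<longrightarrow>
        transport_cost R \<mu> (pushforward m \<mu>) = 0)"
proof (intro conjI ballI allI impI)
  show "surface_dist R M N = transport_cost R \<mu> \<nu>"
    if "M \<in> disk_type_surfaces" "N \<in> disk_type_surfaces" "\<mu> \<in> conformal_factors M" "\<nu> \<in> conformal_factors N"
    for M N :: "'a surface" and \<mu> \<nu>
    using that by (rule surface_dist_eq)
next
  \<comment> \<open>Once a factor is fixed for each surface, \<open>surface_dist_eq\<close> turns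
    every axiom into one about \<open>transport_cost\<close>.\<close>
  have ex: "\<exists>\<mu>. \<mu> \<in> conformal_factors M \<and> disk_density \<mu>" if "M \<in> disk_type_surfaces" for M :: "'a surface"
    using that hyperbolic_density_imp_disk_density unfolding disk_type_surfaces_def conformal_factors_def by blast
  show "semi_metric_on (disk_type_surfaces :: 'a surface set) isometric (surface_dist R)"
    unfolding semi_metric_on_def
  proof (intro conjI ballI impI)
    fix M N :: "'a surface" assume M: "M \<in> disk_type_surfaces" and N: "N \<in> disk_type_surfaces"
    obtain \<mu> where \<mu>: "\<mu> \<in> conformal_factors M" "disk_density \<mu>" using ex[OF M] by blast
    obtain \<nu> where \<nu>: "\<nu> \<in> conformal_factors N" "disk_density \<nu>" using ex[OF N] by blast
    note MN = surface_dist_eq[OF M N \<mu>(1) \<nu>(1), of R]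
    show "surface_dist R M N \<ge> 0" unfolding MN by (rule transport_cost_nonneg[OF \<mu>(2) \<nu>(2)])
    show "surface_dist R M N = surface_dist R N M"
      unfolding MN surface_dist_eq[OF N M \<nu>(1) \<mu>(1)] by (rule transport_cost_sym[OF \<nu>(2) \<mu>(2)])
    show "surface_dist R M P \<le> surface_dist R M N + surface_dist R N P" if P: "P \<in> disk_type_surfaces" for P :: "'a surface"
    proof -
      obtain \<rho> where \<rho>: "\<rho> \<in> conformal_factors P" "disk_density \<rho>" using ex[OF P] by blast
      show ?thesis
        unfolding MN surface_dist_eq[OF N P \<nu>(1) \<rho>(1)] surface_dist_eq[OF M P \<mu>(1) \<rho>(1)]
        by (rule transport_cost_triangle[OF \<mu>(2) \<nu>(2) \<rho>(2)])
    qed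
    show "surface_dist R M N = 0" if iso: "isometric M N"
    proof -
      obtain k where "isometry M N k" using iso unfolding isometric_def by blast
      moreover have "riemannian_surface M" "riemannian_surface N"
        using M N by (auto simp: disk_type_surfaces_def)
      ultimately show ?thesis unfolding MN using transport_cost_isometric \<mu>(1) \<nu>(1) by blast
    qed
  qed
next
  fix \<mu> m assume "hyperbolic_density \<mu> \<and> m \<in> moebius_disk"
  then have \<mu>: "disk_density \<mu>" and m: "m \<in> moebius_disk"
    using hyperbolic_density_imp_disk_density by blast+
  show "transport_cost R \<mu> (pushforward m \<mu>) = 0"
    by (rule transport_cost_moebius[OF \<mu> disk_density_pushforward[OF \<mu> m] m pushforward_moebius_disk[OF m]])
qed

end
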